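(* Let $q\ge1$ and $k\ge1$ be integers, and put $K=\max(k,\omega(q))$. Uniformly for all $x\ge K^{ek}$ we have $$\mathbb E\left(\left|{\sum_{n\le x}}^{\flat}X_n\right|^{2k}\right)^{\frac1{2k}}\le\mathbb E\left(\left|\sum_{n\le x}X_n\right|^{2k}\right)^{\frac1{2k}}\le x^{\frac12}\left(\frac{\log x}{k}\right)^{\frac{(k-1)^2}{2k}}e^{O(k)},$$ and $$\mathbb E\left(\left|{\sum_{n\le x}}^{\flat}X_n\right|^{2k}\right)^{\frac1{2k}}\ge\left({\sum_{N\le x^k}}^{\flat}d_k(N,x)^2\right)^{\frac1{2k}}\ge\frac{x^{\frac12}}{(\log x)^{1-\frac1{2k}}}\left(\frac{\log x}{k\log K}\right)^{\frac k2}\left(\log\left(\frac{\log x}{k\log K}\right)\right)^{O(k)}.$$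
   Context: $(X_n)_{n\ge1}$ is a random completely multiplicative function: for primes $p$, the $X_p$ are independent random variables uniformly distributed on the unit circle, and $X_n=\prod_i X_{p_i}^{a_i}$ if $n=\prod_i p_i^{a_i}$. $\mathbb E$ denotes expectation. ${\sum}^{\flat}$ indicates that the sum is restricted to squarefree integers coprime to $q$. $\omega(q)$ is the number of distinct prime factors of $q$. $d_k(N,x)$ is the number of $k$-tuples $(m_1,\dots,m_k)$ of positive integers with $m_1\cdots m_k=N$ and all $m_i\le x$. Implied constants are absolute.
   Formalization: The last inequality is stated only for K≥2 (log K=0 makes it undefined for K=1) and with an extra factor e^{-O(k)}: at x=K^{ek} the base log(log x/(k log K)) is 1 and the printed bound fails, e.g. for k=1, q=6. For base ≥2 the factor is absorbed in the O(k) power. *)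

theory Defs
  imports
    "HOL-Probability.Probability"
    "HOL-Computational_Algebra.Computational_Algebra"
begin

text \<open>
  The random completely multiplicative function. Multiplicativity is required at every sample
  point; the value \<^term>\<open>X 0\<close> is left unspecified.
\<close>

locale random_completely_multiplicative = prob_space M for M :: "'a measure" +
  fixes X :: "nat \<Rightarrow> 'a \<Rightarrow> complex"
  assumes indep_primes: "indep_vars (\<lambda>_. borel) X {p. prime p}"
    and uniform_circle:
      "\<And>p. prime p \<Longrightarrow> distr M borel (X p) = distr (uniform_measure lborel {0..2*pi}) borel cis"
    and completely_multiplicative:
      "\<And>n \<omega>. n \<ge> 1 \<Longrightarrow> \<omega> \<in> space M \<Longrightarrow>
         X n \<omega> = (\<Prod>p\<in>prime_factors n. X p \<omega> ^ multiplicity p n)"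

definition pos_upto :: "real \<Rightarrow> nat set" where
  "pos_upto x = {n. 1 \<le> n \<and> real n \<le> x}"

text \<open>The index set of a flat sum.\<close>

definition flat_upto :: "nat \<Rightarrow> real \<Rightarrow> nat set" where
  "flat_upto q x = {n \<in> pos_upto x. squarefree n \<and> coprime n q}"

definition restricted_divisor :: "nat \<Rightarrow> nat \<Rightarrow> real \<Rightarrow> nat" where
  "restricted_divisor k N x =
     card {ms. length ms = k \<and> set ms \<subseteq> pos_upto x \<and> prod_list ms = N}"

definition moment_norm :: "'a measure \<Rightarrow> nat \<Rightarrow> ('a \<Rightarrow> complex) \<Rightarrow> real" where
  "moment_norm M k Y = (LINT \<omega>|M. norm (Y \<omega>) ^ (2 * k)) powr (1 / (2 * real k))"

end

(*
  By orthogonality of the X_n, the 2k-th moment of the sum over A counts pairs of k-tuples from A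
  with equal products.

  Upper bound. Two k-tuples with equal products are the row and column products of a k x k matrix of
  positive integers. Rounding the logarithms of the entries down costs a factor exp(O(k^2)); the
  rounded matrix is determined by its upper left (k-1) x (k-1) block and its row and column sums.
  Row and column sums are at most log x, so they contribute x^k exp(O(k)), and the block, whose
  entries add up to at most (k-1) log x, contributes (log x / k)^((k-1)^2) exp(O(k^2)).

  Lower bound. Put W = log x / (k log K) and w = log W. Take pairs of tuples (b_i p_i), (c_i p_i) with
  large distinct primes p_i, where b, c are tuples with the same product, a squarefree number M with
  all prime factors between K^(2w) and x^(1/(8kw)). If the logarithms of b_i and c_i have equal
  integer parts for all i but one, the p_i can be chosen in at least (x/log x)^k exp(-O(k)) / M ways.
  By Cauchy-Schwarz the requirement on the logarithms costs a factor (log x)^(k-1) only.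
  The sum of d_k(M)^2 / M, over the M with k^2 t prime factors that are distributed evenly among
  the k components, is at least exp(k^2 t) up to a factor (k t)^(O(k)); by Mertens' theorem,
  t = w - O(log w) is admissible.
*)
theory Submission
  imports Defs
begin

text \<open>The obstacle is uniformity in k. All estimates concern the 2k-th moment itself, where a
  loss of exp(O(k^2)) is harmless because it becomes exp(O(k)) in the norm.

  In the upper bound the block is treated with a Rankin weight of parameter k / log x: the weight
  costs at most exp(k^2), and each entry contributes O(log x / k).

  In the lower bound the same p_i must fit both b_i and c_i, so max(b_i, c_i) limits it. Equal
  integer parts of the logarithms keep the product of the maxima below exp(k) M, and one coordinate
  may stay free since b and c have the same product. The power 2k - 1 of log x that is lost consists
  of k from the density of the p_i and k - 1 from the classes.

  With J primes per component and n = kJ, the quantity (n! / J!^k)^2 t^n / n! is by Stirling largest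
  near J = kt, where it is about exp(n); hence the k^2 t prime factors. The lower end K^(2w) of
  their range makes primes dividing q and repetitions of primes cost O(1); the upper end keeps every
  component below x^(1/8), so that at least x^(7/8) remains for p_i.\<close>

section \<open>Estimates of Chebyshev and Mertens\<close>

lemma prod_primes_dvd:
  assumes "finite A" "\<And>p. p \<in> A \<Longrightarrow> prime p \<and> p dvd (n::nat)"
  shows "\<Prod>A dvd n"
  using assms
proof (induction A rule: finite_induct)
  case (insert p A)
  have "coprime p (\<Prod>A)"
    using insert by (intro prod_coprime_right primes_coprime) auto
  then show ?case using insert by (simp add: divides_mult)
qed simp

text \<open>Chebyshev's argument: with m the upper half of n, every prime in (m, n] divides the
  binomial coefficient \<open>n choose m\<close>, which is at most 2^n.\<close>

lemma primorial_le: "(\<Prod>p | prime p \<and> p \<le> n. p) \<le> (16::nat) ^ n"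
proof (induction n rule: less_induct)
  case (less n)
  show ?case
  proof (cases "n \<ge> 2")
    case False
    then have "{p::nat. prime p \<and> p \<le> n} = {}"
      by (auto dest!: prime_ge_2_nat)
    then show ?thesis by (simp only: prod.empty) simp
  next
    case True
    define m where "m = Suc n div 2"
    have m: "m < n" "n \<le> 2 * m" "2 * m \<le> n + 1" using True by (auto simp: m_def)
    let ?A = "{p::nat. prime p \<and> p \<le> m}" and ?B = "{p::nat. prime p \<and> m < p \<and> p \<le> n}"
    have "(\<Prod>p\<in>?B. p) dvd (n choose m)"
    proof (rule prod_primes_dvd)
      fix p assume p: "p \<in> ?B"
      then have "p dvd fact n" by (simp add: prime_dvd_fact_iff)
      moreover have "fact n = fact m * fact (n - m) * (n choose m)"
        using binomial_fact_lemma[of m n] m by simp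
      moreover have "\<not> p dvd fact m" "\<not> p dvd fact (n - m)"
        using p m by (auto simp: prime_dvd_fact_iff)
      ultimately show "prime p \<and> p dvd (n choose m)" using p by (auto simp: prime_dvd_mult_iff)
    qed simp
    then have B: "(\<Prod>p\<in>?B. p) \<le> 2 ^ n"
      using dvd_imp_le[of "\<Prod>p\<in>?B. p" "n choose m"] m binomial_le_pow2[of n m] zero_less_binomial[of m n]
      by linarith
    have "{p. prime p \<and> p \<le> n} = ?A \<union> ?B" using m by auto
    then have "(\<Prod>p | prime p \<and> p \<le> n. p) = (\<Prod>p\<in>?A. p) * (\<Prod>p\<in>?B. p)"
      by (simp add: prod.union_disjoint disjoint_iff)
    also have "\<dots> \<le> 16 ^ m * 2 ^ n" using less[OF m(1)] B by (intro mult_mono) auto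
    also have "\<dots> = 2 ^ (4 * m + n)" by (simp add: power_add power_mult)
    also have "\<dots> \<le> 2 ^ (4 * n)"
    proof (rule power_increasing)
      \<comment> \<open>The inequality 4m <= 3n follows from 2m <= n + 1 and n >= 2; the base 16 =
        2^4 leaves room for the rounding in m.\<close>
      show "4 * m + n \<le> 4 * n" using m True by linarith
    qed simp
    also have "\<dots> = 16 ^ n" by (simp add: power_mult)
    finally show ?thesis .
  qed
qed

text \<open>Legendre's formula as a recursion: only the n div p multiples of p matter, and dividing
  each of them by p leaves (n div p)!. In the induction both sides change only when p divides
  \<open>Suc n\<close>.\<close>

lemma multiplicity_fact_rec:
  assumes "prime (p::nat)"
  shows "multiplicity p (fact n :: nat) = n div p + multiplicity p (fact (n div p) :: nat)"
proof (induction n)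
  case (Suc n)
  have p: "p > 0" "p \<noteq> 1" using assms prime_gt_0_nat by (auto intro: prime_nat_iff[THEN iffD1])
  have E: "multiplicity p (fact (Suc n) :: nat) = multiplicity p (Suc n) + multiplicity p (fact n :: nat)" for n
    using assms prime_elem_multiplicity_mult_distrib[of p "Suc n" "fact n"] by simp
  show ?case
  proof (cases "p dvd Suc n")
    case False
    then have "multiplicity p (Suc n) = 0" by (simp add: not_dvd_imp_multiplicity_0)
    then show ?thesis using Suc E[of n] False
      by (simp add: div_Suc dvd_eq_mod_eq_0)
  next
    case True
    define k where "k = n div p"
    have d: "Suc n div p = Suc k" using True by (simp add: div_Suc k_def dvd_eq_mod_eq_0)
    then have s: "Suc n = p * Suc k" using True by (metis dvd_mult_div_cancel)
    have "multiplicity p (Suc n) = Suc (multiplicity p (Suc k))"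
      unfolding s using p assms by (intro multiplicity_times_same) auto
    then show ?thesis unfolding d using Suc E[of n] E[of k] by (simp add: k_def)
  qed
qed simp

text \<open>Unfolding the recursion bounds the multiplicity by the geometric series n/p + n/p^2 +
  ... = n/(p - 1).\<close>

lemma multiplicity_fact_le:
  assumes "prime (p::nat)"
  shows "multiplicity p (fact n :: nat) * (p - 1) \<le> n"
proof (induction n rule: less_induct)
  case (less n)
  show ?case
  proof (cases "n = 0")
    case False
    have p: "p \<ge> 2" using assms prime_ge_2_nat by blast
    then have "n div p < n" using False by simp
    then have "multiplicity p (fact n :: nat) * (p - 1) \<le> n div p * (p - 1) + n div p"
      using less[of "n div p"] by (subst multiplicity_fact_rec[OF assms]) (simp add: algebra_simps)
    also have "\<dots> = n div p * p" using p by (simp add: diff_mult_distrib2)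
    also have "\<dots> \<le> n" by simp
    finally show ?thesis .
  qed simp
qed

lemma ln_fact_eq_sum_primes:
  "ln (fact n :: real) = (\<Sum>p | prime p \<and> p \<le> n. real (multiplicity p (fact n :: nat)) * ln (real p))"
proof -
  have "(fact n :: nat) = (\<Prod>p\<in>prime_factors (fact n). p ^ multiplicity p (fact n :: nat))"
    by (simp add: prime_factorization_nat)
  from arg_cong[OF this, of real]
  have "(fact n :: real) = (\<Prod>p\<in>prime_factors (fact n :: nat). real p ^ multiplicity p (fact n :: nat))"
    by (simp only: of_nat_fact of_nat_prod of_nat_power)
  then have "ln (fact n :: real) = (\<Sum>p\<in>prime_factors (fact n :: nat). ln (real p ^ multiplicity p (fact n :: nat)))"
    by (simp only:) (intro ln_prod, auto simp: prime_factors_gt_0_nat)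
  also have "prime_factors (fact n :: nat) = {p. prime p \<and> p \<le> n}"
    by (auto simp: prime_factors_dvd prime_dvd_fact_iff)
  finally show ?thesis
    by (simp add: ln_realpow prime_gt_0_nat)
qed

text \<open>n^n / n! is a single term of the exponential series at n.\<close>

lemma ln_fact_ge: "real n * ln (real n) - real n \<le> ln (fact n)"
proof -
  have "(\<Sum>k\<in>{n}. real n ^ k / fact k) \<le> exp (real n)"
    unfolding exp_def using summable_exp_generic[of "real n"]
    by (subst sum.cong[OF refl, of _ _ "\<lambda>k. real n ^ k /\<^sub>R fact k"])
      (auto simp: divide_inverse_commute intro!: sum_le_suminf[of _ "{n}", simplified])
  then have "real n ^ n \<le> exp (real n) * fact n" by (simp add: field_simps)
  then have "ln (real n ^ n) \<le> ln (exp (real n) * fact n)" if "n > 0"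
    using that by (subst ln_le_cancel_iff) auto
  then show ?thesis by (cases "n = 0") (auto simp: ln_realpow ln_mult)
qed

lemma ln_fact_le: "ln (fact n) \<le> real n * ln (real n)"
proof (cases "n = 0")
  case False
  have "ln (fact n) \<le> ln (real (n ^ n))"
    using False fact_le_power[of n, where 'a=real] by (subst ln_le_cancel_iff) auto
  then show ?thesis using False by (simp add: ln_realpow)
qed simp

section \<open>Mertens' first theorem and Chebyshev's lower bound for the number of primes\<close>

definition prime_log_sum :: "nat \<Rightarrow> real" where
  "prime_log_sum n = (\<Sum>p | prime p \<and> p \<le> n. ln (real p) / real p)"

text \<open>ln(n!) is at least the sum of floor(n/p) ln p. Dropping the floors costs the sum of ln p
  over p <= n, which \<open>primorial_le\<close> bounds by n ln 16.\<close>

lemma prime_log_sum_le: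
  assumes "n \<ge> 1" shows "prime_log_sum n \<le> ln (real n) + ln 16"
proof -
  let ?P = "{p. prime p \<and> p \<le> n}"
  have ln_pos: "ln (real p) \<ge> 0" if "p \<in> ?P" for p using that prime_ge_1_nat by simp
  have theta: "(\<Sum>p\<in>?P. ln (real p)) \<le> real n * ln 16"
  proof -
    have "(\<Sum>p\<in>?P. ln (real p)) = ln (\<Prod>p\<in>?P. real p)"
      by (intro ln_prod[symmetric]) (auto simp: prime_gt_0_nat)
    also have "\<dots> \<le> ln (16 ^ n)"
    proof (subst ln_le_cancel_iff)
      show "(\<Prod>p\<in>?P. real p) \<le> 16 ^ n"
        using iffD2[OF of_nat_le_iff[where 'a=real] primorial_le[of n]] by simp
    qed (auto intro!: prod_pos simp: prime_gt_0_nat)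
    finally show ?thesis by (simp add: ln_realpow)
  qed
  have "real n * prime_log_sum n - real n * ln 16 \<le> (\<Sum>p\<in>?P. (real n / real p - 1) * ln (real p))"
    using theta by (simp add: prime_log_sum_def sum_distrib_left algebra_simps sum_subtractf)
  also have "\<dots> \<le> (\<Sum>p\<in>?P. real (multiplicity p (fact n :: nat)) * ln (real p))"
  proof (intro sum_mono mult_right_mono ln_pos)
    fix p assume "p \<in> ?P"
    then have "real (n div p) \<le> real (multiplicity p (fact n :: nat))"
      by (subst multiplicity_fact_rec) auto
    then show "real n / real p - 1 \<le> real (multiplicity p (fact n :: nat))"
      using floor_divide_of_nat_eq[of n p, where 'a=real] by linarith
  qed auto
  also have "\<dots> \<le> real n * ln (real n)"
    using ln_fact_le[of n] by (simp add: ln_fact_eq_sum_primes)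
  finally have "real n * (prime_log_sum n - ln 16) \<le> real n * ln (real n)"
    by (simp add: algebra_simps)
  then show ?thesis using assms by simp
qed

lemma prime_log_sum_ge: "\<exists>C>0. \<forall>n\<ge>1. ln (real n) - C \<le> prime_log_sum n"
proof -
  \<comment> \<open>Summable majorant of ln p / (p (p - 1)), the cost of replacing 1/(p - 1) by 1/p;
    it comes from ln p <= 2 sqrt p and p - 1 >= p/2.\<close>
  define g where "g = (\<lambda>n::nat. 4 * real n powr (-3/2))"
  have summ: "summable g" unfolding g_def
    by (intro summable_mult) (simp add: summable_real_powr_iff)
  have g0: "g n \<ge> 0" for n by (simp add: g_def)
  have "ln (real n) - (1 + suminf g) \<le> prime_log_sum n" if n: "n \<ge> 1" for n
  proof -
    let ?P = "{p. prime p \<and> p \<le> n}"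
    have "real n * ln (real n) - real n \<le> (\<Sum>p\<in>?P. real (multiplicity p (fact n :: nat)) * ln (real p))"
      using ln_fact_ge[of n] by (simp add: ln_fact_eq_sum_primes)
    also have "\<dots> \<le> (\<Sum>p\<in>?P. real n * (ln (real p) / real p + g p))"
    proof (intro sum_mono)
      fix p assume p: "p \<in> ?P"
      then have p2: "p \<ge> 2" using prime_ge_2_nat by blast
      have "real (multiplicity p (fact n :: nat) * (p - 1)) \<le> real n"
        using multiplicity_fact_le[of p n] p by (subst of_nat_le_iff) auto
      then have "real (multiplicity p (fact n :: nat)) \<le> real n / (real p - 1)"
        using p2 by (simp add: field_simps of_nat_diff)
      then have "real (multiplicity p (fact n :: nat)) * ln (real p) \<le> real n / (real p - 1) * ln (real p)"
        using p2 by (intro mult_right_mono) auto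
      also have "\<dots> = real n * (ln (real p) / real p + ln (real p) / (real p * (real p - 1)))"
        using p2 by (simp add: field_simps)
      also have "\<dots> \<le> real n * (ln (real p) / real p + g p)"
      proof (intro mult_left_mono add_left_mono)
        have "ln (real p) \<le> 2 * sqrt (real p)"
          using p2 ln_le_minus_one[of "sqrt (real p)"] ln_sqrt[of "real p"] by simp
        then have "ln (real p) / (real p * (real p - 1)) \<le> (2 * sqrt (real p)) / (real p * (real p / 2))"
          using p2 by (intro frac_le mult_left_mono) auto
        also have "\<dots> = 4 * (sqrt (real p) / (real p * real p))" by simp
        also have "sqrt (real p) / (real p * real p) = real p powr (1/2 - 2)"
          using p2 by (subst powr_diff) (auto simp: powr_half_sqrt power2_eq_square)
        finally show "ln (real p) / (real p * (real p - 1)) \<le> g p" by (simp add: g_def)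
      qed auto
      finally show "real (multiplicity p (fact n :: nat)) * ln (real p) \<le> real n * (ln (real p) / real p + g p)" .
    qed
    also have "\<dots> = real n * (prime_log_sum n + (\<Sum>p\<in>?P. g p))"
      by (simp add: prime_log_sum_def sum_distrib_left sum.distrib algebra_simps)
    also have "\<dots> \<le> real n * (prime_log_sum n + suminf g)"
      by (intro mult_left_mono add_left_mono sum_le_suminf summ) (auto simp: g0)
    finally have "real n * (ln (real n) - 1) \<le> real n * (prime_log_sum n + suminf g)"
      by (simp add: algebra_simps)
    then show ?thesis using n by simp
  qed
  moreover have "1 + suminf g > 0" using suminf_nonneg[OF summ] g0 by (simp add: add_pos_nonneg)
  ultimately show ?thesis by blast
qed

lemma mertens_first: "\<exists>C>0. \<forall>n\<ge>1. \<bar>prime_log_sum n - ln (real n)\<bar> \<le> C"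
proof -
  obtain C where "C > 0" "\<forall>n\<ge>1. ln (real n) - C \<le> prime_log_sum n" using prime_log_sum_ge by blast
  moreover have "prime_log_sum n - ln (real n) \<le> max C (ln 16)" if "n \<ge> 1" for n
    using prime_log_sum_le[OF that] by linarith
  ultimately show ?thesis by (intro exI[of _ "max C (ln 16)"]) (force simp: abs_le_iff)
qed

lemma prime_log_sum_Suc:
  "prime_log_sum (Suc n) = prime_log_sum n + (if prime (Suc n) then ln (real (Suc n)) / real (Suc n) else 0)"
proof -
  have "{p. prime p \<and> p \<le> Suc n} = {p. prime p \<and> p \<le> n} \<union> (if prime (Suc n) then {Suc n} else {})"
    by (auto simp: le_Suc_eq)
  then show ?thesis unfolding prime_log_sum_def by (auto simp: sum.insert)
qed

lemma prime_log_sum_diff: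
  assumes "m \<le> n"
  shows "prime_log_sum n - prime_log_sum m = (\<Sum>p | prime p \<and> m < p \<and> p \<le> n. ln (real p) / real p)"
proof -
  have "{p. prime p \<and> p \<le> n} = {p. prime p \<and> p \<le> m} \<union> {p. prime p \<and> m < p \<and> p \<le> n}"
    using assms by auto
  then show ?thesis unfolding prime_log_sum_def by (simp add: sum.union_disjoint disjoint_iff)
qed

text \<open>The terms ln p / p with n/A < p <= n add up to at least 1, while each of them is at most
  A ln u / n; so there are many.\<close>

lemma prime_count_ge:
  "\<exists>c>0. \<exists>u0. \<forall>u\<ge>u0. c * u / ln u \<le> real (card {p. prime p \<and> real p \<le> u})"
proof -
  obtain C where C: "C > 0" "\<And>n. n \<ge> 1 \<Longrightarrow> \<bar>prime_log_sum n - ln (real n)\<bar> \<le> C" using mertens_first by blast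
  \<comment> \<open>The window (n/A, n] has logarithmic length 2C + 1; the Mertens errors at its two
    ends use up 2C of it.\<close>
  define A where "A = exp (2 * C + 1)"
  have A: "A > 1" using C by (simp add: A_def)
  have "1 / (2 * A) * u / ln u \<le> real (card {p. prime p \<and> real p \<le> u})" if u: "u \<ge> 2 * A + 2" for u
  proof -
    define n where "n = nat \<lfloor>u\<rfloor>"
    define m where "m = nat \<lfloor>real n / A\<rfloor>"
    have n: "real n \<le> u" "u / 2 \<le> real n" "real n \<ge> A" "n \<ge> 1" using u A unfolding n_def by linarith+
    then have nA: "real n / A \<ge> 1" using A by simp
    then have m: "m \<ge> 1" "real m \<le> real n / A" "real n / A < real m + 1" unfolding m_def by linarith+
    have mn: "m \<le> n"
    proof -
      have "real n / A \<le> real n / 1" using A by (intro divide_left_mono) auto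
      then show ?thesis using m by linarith
    qed
    let ?P = "{p. prime p \<and> m < p \<and> p \<le> n}"
    have "ln (real m) \<le> ln (real n / A)" using m by (subst ln_le_cancel_iff) auto
    also have "\<dots> = ln (real n) - (2 * C + 1)" using n A by (subst ln_div) (auto simp: A_def)
    finally have "1 \<le> prime_log_sum n - prime_log_sum m"
      using C(2)[of n] C(2)[of m] n m by linarith
    also have "\<dots> = (\<Sum>p\<in>?P. ln (real p) / real p)" using prime_log_sum_diff mn by blast
    also have "\<dots> \<le> (\<Sum>p\<in>?P. ln u / (real n / A))"
    proof (intro sum_mono frac_le)
      fix p assume p: "p \<in> ?P"
      then have "real p \<ge> real m + 1" by auto
      then show "real n / A \<le> real p" using m by linarith
      show "ln (real p) \<le> ln u" using p n prime_gt_0_nat by (subst ln_le_cancel_iff) auto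
    qed (use n A u in auto)
    also have "\<dots> = real (card ?P) * (ln u * A / real n)" by simp
    also have "\<dots> \<le> real (card {p. prime p \<and> real p \<le> u}) * (ln u * A / (u / 2))"
    proof (intro mult_mono frac_le)
      have "finite {p. prime p \<and> real p \<le> u}"
        by (rule finite_subset[of _ "{..n}"]) (auto simp: n_def le_nat_floor)
      then show "real (card ?P) \<le> real (card {p. prime p \<and> real p \<le> u})"
        using n by (intro of_nat_mono card_mono) auto
    qed (use n A u in auto)
    finally show ?thesis using A u by (simp add: field_simps)
  qed
  then show ?thesis using A by (intro exI[of _ "1 / (2 * A)"]) auto
qed

text \<open>
  Abel summation compares \<open>ln p / p\<close> with \<open>ln (i + 1) - ln i\<close>, whose sum weighted by \<open>1 / ln i\<close>
  dominates the telescoping sum of \<open>ln (ln (i + 1)) - ln (ln i)\<close>.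
\<close>

lemma mertens_second_nat:
  "\<exists>C>0. \<forall>a b::nat. 1 \<le> a \<longrightarrow> a \<le> b \<longrightarrow>
     ln (ln (real b + 1)) - ln (ln (real a + 1)) - C \<le> (\<Sum>p | prime p \<and> a < p \<and> p \<le> b. 1 / real p)"
proof -
  obtain C0 where C0: "C0 > 0" "\<And>n. n \<ge> 1 \<Longrightarrow> \<bar>prime_log_sum n - ln (real n)\<bar> \<le> C0" using mertens_first by blast
  define g where "g = (\<lambda>m::nat. 1 / ln (real m))"
  define f where "f = (\<lambda>m. (if prime m then ln (real m) / real m else 0) - (ln (real m + 1) - ln (real m)))"
  \<comment> \<open>Two Mertens errors \<open>C0\<close>, and 1 for ln(m + 1) - ln m.\<close>
  define B where "B = 2 * C0 + 1"
  have "ln (ln (real b + 1)) - ln (ln (real a + 1)) - B * g 2 \<le> (\<Sum>p | prime p \<and> a < p \<and> p \<le> b. 1 / real p)"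
    if ab: "1 \<le> a" "a \<le> b" for a b :: nat
  proof -
    define D where "D = (\<lambda>m. \<Sum>i\<in>{a<..m}. f i)"
    have D_eq: "D m = prime_log_sum m - prime_log_sum a - (ln (real m + 1) - ln (real a + 1))" if "m \<ge> a" for m
      using that
    proof (induction m rule: dec_induct)
      case (step n)
      have "{a<..Suc n} = insert (Suc n) {a<..n}" using step by auto
      then show ?case using step by (simp add: D_def f_def prime_log_sum_Suc add.commute)
    qed (simp add: D_def)
    have D_bd: "D m \<ge> - B" if "m \<ge> a" for m
    proof -
      have "ln (real m + 1) - ln (real m) \<le> 1"
      proof -
        have "ln (real m + 1) \<le> ln (2 * real m)" using that ab by (subst ln_le_cancel_iff) auto
        also have "\<dots> = ln 2 + ln (real m)" using that ab by (subst ln_mult) auto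
        finally show ?thesis using ln_2_less_1 by linarith
      qed
      moreover have "ln (real a) \<le> ln (real a + 1)" using ab by simp
      moreover have "\<bar>prime_log_sum m - ln (real m)\<bar> \<le> C0" "\<bar>prime_log_sum a - ln (real a)\<bar> \<le> C0"
        using that ab C0(2) by auto
      ultimately show ?thesis unfolding D_eq[OF that] B_def by linarith
    qed
    \<comment> \<open>One-sided summation by parts: in each step \<open>D n\<close> is replaced by
      its lower bound \<open>- B\<close>, at the price of B times the decrease of \<open>g\<close>,
      and these prices telescope.\<close>
    have abel: "(\<Sum>i\<in>{a<..m}. f i * g i) \<ge> D m * g m - B * (g (Suc a) - g m)" if "m \<ge> Suc a" for m
      using that
    proof (induction m rule: dec_induct)
      case base
      have "{a<..Suc a} = {Suc a}" by auto
      then show ?case by (simp add: D_def)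
    next
      case (step n)
      have "{a<..Suc n} = insert (Suc n) {a<..n}" using step by auto
      then have E: "(\<Sum>i\<in>{a<..Suc n}. f i * g i) = (\<Sum>i\<in>{a<..n}. f i * g i) + (D (Suc n) - D n) * g (Suc n)"
        by (simp add: D_def)
      have "g (Suc n) \<le> g n" unfolding g_def using step ab by (intro divide_left_mono mult_pos_pos) auto
      then have "(D n + B) * (g n - g (Suc n)) \<ge> 0" using D_bd[of n] step by auto
      then show ?case unfolding E using step by (simp add: algebra_simps)
    qed
    have g0: "g m \<ge> 0" for m by (cases "m = 0") (auto simp: g_def)
    have main: "(\<Sum>i\<in>{a<..b}. f i * g i) \<ge> - B * g 2"
    proof (cases "a = b")
      case True
      have "B * g 2 \<ge> 0" using C0 g0[of 2] by (simp add: B_def)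
      then show ?thesis using True by simp
    next
      case False
      then have "(\<Sum>i\<in>{a<..b}. f i * g i) \<ge> D b * g b - B * (g (Suc a) - g b)" using ab abel by simp
      moreover have "(D b + B) * g b \<ge> 0" using D_bd[of b] g0[of b] ab by simp
      moreover have "B * g (Suc a) \<le> B * g 2" unfolding g_def
        using ab C0 by (intro mult_left_mono divide_left_mono) (auto simp: B_def)
      ultimately show ?thesis by (simp add: algebra_simps)
    qed
    have step: "ln (ln (real i + 1)) - ln (ln (real i)) \<le> (ln (real i + 1) - ln (real i)) * g i" if "i > a" for i
    proof -
      have i: "ln (real i) > 0" "ln (real i + 1) > 0" using that ab by auto
      have "ln (ln (real i + 1)) - ln (ln (real i)) = ln (ln (real i + 1) / ln (real i))"
        using i by (simp add: ln_div)
      also have "\<dots> \<le> ln (real i + 1) / ln (real i) - 1" using i by (intro ln_le_minus_one) auto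
      also have "\<dots> = (ln (real i + 1) - ln (real i)) * g i" using i by (simp add: g_def field_simps)
      finally show ?thesis .
    qed
    have "ln (ln (real b + 1)) - ln (ln (real a + 1)) = (\<Sum>i\<in>{a<..b}. ln (ln (real i + 1)) - ln (ln (real i)))"
      using ab(2)
    proof (induction b rule: dec_induct)
      case (step n)
      have "{a<..Suc n} = insert (Suc n) {a<..n}" using step by auto
      then show ?case using step by (simp add: add.commute)
    qed simp
    also have "\<dots> \<le> (\<Sum>i\<in>{a<..b}. (ln (real i + 1) - ln (real i)) * g i)" by (intro sum_mono step) auto
    also have "\<dots> = (\<Sum>i\<in>{a<..b}. (if prime i then 1 / real i else 0) - f i * g i)"
    proof (intro sum.cong refl)
      fix i assume "i \<in> {a<..b}"
      then have "ln (real i) > 0" using ab by auto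
      then show "(ln (real i + 1) - ln (real i)) * g i = (if prime i then 1 / real i else 0) - f i * g i"
        by (simp add: f_def g_def field_simps)
    qed
    also have "\<dots> = (\<Sum>i\<in>{a<..b}. if prime i then 1 / real i else 0) - (\<Sum>i\<in>{a<..b}. f i * g i)"
      by (rule sum_subtractf)
    also have "(\<Sum>i\<in>{a<..b}. if prime i then 1 / real i else 0) = (\<Sum>p | prime p \<and> a < p \<and> p \<le> b. 1 / real p)"
      by (subst sum.inter_filter[symmetric]) (auto intro!: sum.cong)
    finally show ?thesis using main by linarith
  qed
  moreover have "B * g 2 > 0" using C0 by (simp add: B_def g_def)
  ultimately show ?thesis by blast
qed

lemma mertens_second:
  "\<exists>C>0. \<forall>z y::real. 2 \<le> z \<longrightarrow> z \<le> y \<longrightarrow>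
     ln (ln y / ln z) - C \<le> (\<Sum>p | prime p \<and> z < real p \<and> real p \<le> y. 1 / real p)"
proof -
  obtain C where C: "C > 0" "\<And>a b::nat. 1 \<le> a \<Longrightarrow> a \<le> b \<Longrightarrow>
     ln (ln (real b + 1)) - ln (ln (real a + 1)) - C \<le> (\<Sum>p | prime p \<and> a < p \<and> p \<le> b. 1 / real p)"
    using mertens_second_nat by blast
  have "ln (ln y / ln z) - (C + ln 2) \<le> (\<Sum>p | prime p \<and> z < real p \<and> real p \<le> y. 1 / real p)"
    if zy: "2 \<le> z" "z \<le> y" for z y :: real
  proof -
    define a where "a = nat \<lfloor>z\<rfloor>"
    define b where "b = nat \<lfloor>y\<rfloor>"
    have ab: "1 \<le> a" "a \<le> b" "real a \<le> z" "z < real a + 1" "real b \<le> y" "y < real b + 1"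
      using zy unfolding a_def b_def by linarith+
    have "{p. prime p \<and> z < real p \<and> real p \<le> y} = {p. prime p \<and> a < p \<and> p \<le> b}"
    proof (intro Collect_cong conj_cong refl)
      fix p
      show "(z < real p) = (a < p)" using zy unfolding a_def by linarith
      show "(real p \<le> y) = (p \<le> b)" using zy unfolding b_def by linarith
    qed
    moreover have "ln (ln y) \<le> ln (ln (real b + 1))" using zy ab by (subst ln_le_cancel_iff) auto
    moreover have "ln (ln (real a + 1)) \<le> ln (2 * ln z)"
    proof (subst ln_le_cancel_iff)
      \<comment> \<open>Passing from z to a + 1 at most squares z, so ln z at most doubles and the
        double logarithm grows by at most ln 2.\<close>
      have "real a + 1 \<le> z * z"
      proof -
        have "z * 2 \<le> z * z" using zy by (intro mult_left_mono) auto
        then show ?thesis using zy ab by linarith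
      qed
      then have "ln (real a + 1) \<le> ln (z * z)" using ab zy by (subst ln_le_cancel_iff) auto
      also have "\<dots> = 2 * ln z" using zy by (subst ln_mult) auto
      finally show "ln (real a + 1) \<le> 2 * ln z" .
    qed (use zy ab in auto)
    moreover have "ln (2 * ln z) = ln 2 + ln (ln z)" using zy by (subst ln_mult) auto
    moreover have "ln (ln y / ln z) = ln (ln y) - ln (ln z)" using zy by (subst ln_div) auto
    ultimately show ?thesis using C(2)[OF ab(1,2)] by simp
  qed
  then show ?thesis using C(1) by (intro exI[of _ "C + ln 2"]) (auto simp: add_pos_pos)
qed

section \<open>Moments count pairs of tuples with equal products\<close>

lemma finite_pos_upto: "finite (pos_upto x)"
  by (rule finite_subset[of _ "{..nat \<lfloor>x\<rfloor>}"]) (auto simp: pos_upto_def le_nat_floor)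

definition product_pairs :: "nat set \<Rightarrow> nat \<Rightarrow> (nat list \<times> nat list) set" where
  "product_pairs A k = {(ms, ns). set ms \<subseteq> A \<and> length ms = k \<and> set ns \<subseteq> A \<and> length ns = k \<and>
     prod_list ms = prod_list ns}"

lemma finite_product_pairs: "finite A \<Longrightarrow> finite (product_pairs A k)"
  by (rule finite_subset[of _ "{ms. set ms \<subseteq> A \<and> length ms = k} \<times> {ms. set ms \<subseteq> A \<and> length ms = k}"])
    (auto simp: product_pairs_def finite_lists_length_eq)

lemma sum_power_eq_sum_lists:
  fixes f :: "'b \<Rightarrow> 'c::comm_semiring_1"
  assumes "finite A"
  shows "(\<Sum>a\<in>A. f a) ^ k = (\<Sum>xs | set xs \<subseteq> A \<and> length xs = k. prod_list (map f xs))"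
proof (induction k)
  case 0
  have "{xs. set xs \<subseteq> A \<and> length xs = 0} = {[]}" by auto
  then show ?case by simp
next
  case (Suc k)
  have "(\<Sum>xs | set xs \<subseteq> A \<and> length xs = Suc k. prod_list (map f xs))
      = (\<Sum>(xs, a)\<in>{xs. set xs \<subseteq> A \<and> length xs = k} \<times> A. f a * prod_list (map f xs))"
    unfolding lists_length_Suc_eq
    by (subst sum.reindex) (auto intro!: inj_onI sum.cong)
  also have "\<dots> = (\<Sum>a\<in>A. f a) * (\<Sum>xs | set xs \<subseteq> A \<and> length xs = k. prod_list (map f xs))"
    by (subst sum.cartesian_product[symmetric]) (simp add: sum_distrib_left sum_distrib_right sum.swap[of _ A])
  finally show ?case using Suc by simp
qed

section \<open>Orthogonality of the random multiplicative function\<close>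

lemma borel_measurable_cis [measurable]: "cis \<in> borel_measurable borel"
  by (intro borel_measurable_continuous_onI continuous_intros)

lemma integral_cis_multiple:
  "(LINT t|uniform_measure lborel {0..2*pi}. cis (of_int j * t)) = (if j = 0 then 1 else 0)"
proof -
  have "uniform_measure lborel {0..2*pi} = density lborel (\<lambda>t. ennreal (indicator {0..2*pi} t / (2*pi)))"
    unfolding uniform_measure_def
    by (intro density_cong) (auto simp: divide_ennreal[of 1 "2 * pi", simplified] split: split_indicator intro!: AE_I2)
  then have "(LINT t|uniform_measure lborel {0..2*pi}. cis (of_int j * t))
      = (LINT t|density lborel (\<lambda>t. ennreal (indicator {0..2*pi} t / (2*pi))). cis (of_int j * t))"
    by simp
  also have "\<dots> = (LINT t|lborel. (indicator {0..2*pi} t / (2*pi)) *\<^sub>R cis (of_int j * t))"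
    by (rule integral_density) (auto intro!: AE_I2)
  also have "\<dots> = (LINT t|lborel. indicator {0..2*pi} t *\<^sub>R (cis (of_int j * t) / (2*pi)))"
    by (intro Bochner_Integration.integral_cong refl) (auto split: split_indicator simp: scaleR_conv_of_real)
  also have "\<dots> = (if j = 0 then 1 else 0)"
  proof (cases "j = 0")
    case True
    define c where "c = (1 / (2*pi) :: complex)"
    have "(LINT t|lborel. indicator {0..2*pi} t *\<^sub>R (cis (of_int j * t) / (2*pi)))
        = (2*pi) *\<^sub>R c - 0 *\<^sub>R c"
    proof (rule integral_FTC_Icc)
      fix t :: real
      show "((\<lambda>t. t *\<^sub>R c) has_vector_derivative cis (of_int j * t) / (2*pi)) (at t within {0..2*pi})"
        unfolding has_vector_derivative_def using True
        by (auto intro!: derivative_eq_intros simp: c_def)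
    qed (auto intro!: continuous_intros)
    then show ?thesis using True by (simp add: c_def scaleR_conv_of_real)
  next
    case False
    \<comment> \<open>Normalised so that cis(jt) c is an antiderivative of the integrand; being 2 pi
      periodic, it has equal values at both ends.\<close>
    define c where "c = (1 / (2*pi * \<i> * of_int j) :: complex)"
    have c: "\<i> * of_int j * c = 1 / (2*pi)" using False by (simp add: c_def)
    have "(LINT t|lborel. indicator {0..2*pi} t *\<^sub>R (cis (of_int j * t) / (2*pi)))
        = cis (of_int j * (2*pi)) * c - cis (of_int j * 0) * c"
    proof (rule integral_FTC_Icc)
      fix t :: real
      have "((\<lambda>t. cis (of_int j * t) * c) has_derivative
          (\<lambda>h. (of_int j * h) *\<^sub>R (\<i> * cis (of_int j * t)) * c)) (at t within {0..2*pi})"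
        by (intro has_derivative_mult_left has_derivative_cis has_derivative_mult_right has_derivative_ident)
      also have "(\<lambda>h. (of_int j * h) *\<^sub>R (\<i> * cis (of_int j * t)) * c)
          = (\<lambda>h. h *\<^sub>R (cis (of_int j * t) * (\<i> * of_int j * c)))"
        by (simp add: fun_eq_iff scaleR_conv_of_real mult_ac)
      finally show "((\<lambda>t. cis (of_int j * t) * c) has_vector_derivative cis (of_int j * t) / (2*pi)) (at t within {0..2*pi})"
        unfolding has_vector_derivative_def c by simp
    qed (auto intro!: continuous_intros)
    also have "cis (of_int j * (2*pi)) = 1"
      using cis_multiple_2pi[of "of_int j"] by (simp add: mult_ac)
    finally show ?thesis using False by simp
  qed
  finally show ?thesis .
qed

context random_completely_multiplicative
begin

lemma X_prime_measurable [measurable]: "prime p \<Longrightarrow> X p \<in> borel_measurable M"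
  using indep_primes by (auto simp: indep_vars_def)

text \<open>Padding with primes of multiplicity 0 allows several arguments to be expanded over one
  common set of primes.\<close>

lemma X_eq_prod:
  assumes "finite P" "prime_factors n \<subseteq> P" "\<And>p. p \<in> P \<Longrightarrow> prime p" "n \<ge> 1" "\<omega> \<in> space M"
  shows "X n \<omega> = (\<Prod>p\<in>P. X p \<omega> ^ multiplicity p n)"
  unfolding completely_multiplicative[OF assms(4,5)]
proof (rule prod.mono_neutral_left)
  show "\<forall>i\<in>P - prime_factors n. X i \<omega> ^ multiplicity i n = 1"
    using assms by (auto simp: prime_factors_multiplicity)
qed (use assms in auto)

lemma X_mult:
  assumes "m \<ge> 1" "n \<ge> 1" "\<omega> \<in> space M"
  shows "X (m * n) \<omega> = X m \<omega> * X n \<omega>"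
proof -
  let ?P = "prime_factors m \<union> prime_factors n"
  have "X (m * n) \<omega> = (\<Prod>p\<in>?P. X p \<omega> ^ multiplicity p (m * n))"
    using assms by (intro X_eq_prod) (auto simp: prime_factors_product)
  also have "\<dots> = (\<Prod>p\<in>?P. X p \<omega> ^ multiplicity p m * X p \<omega> ^ multiplicity p n)"
  proof (intro prod.cong refl)
    fix p assume "p \<in> ?P"
    then have "multiplicity p (m * n) = multiplicity p m + multiplicity p n"
      using assms by (intro prime_elem_multiplicity_mult_distrib) auto
    then show "X p \<omega> ^ multiplicity p (m * n) = X p \<omega> ^ multiplicity p m * X p \<omega> ^ multiplicity p n"
      by (simp add: power_add)
  qed
  also have "\<dots> = X m \<omega> * X n \<omega>"
    using assms by (subst prod.distrib, subst (1 2) X_eq_prod[of ?P]) auto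
  finally show ?thesis .
qed

lemma X_1: "\<omega> \<in> space M \<Longrightarrow> X 1 \<omega> = 1"
  by (subst completely_multiplicative) auto

lemma X_prod_list:
  assumes "\<omega> \<in> space M" "\<forall>m\<in>set ms. m \<ge> 1"
  shows "prod_list (map (\<lambda>m. X m \<omega>) ms) = X (prod_list ms) \<omega>"
  using assms(2)
proof (induction ms)
  case (Cons m ms)
  have "prod_list ms \<ge> 1" using Cons.prems by (auto simp: Suc_le_eq prod_list_zero_iff neq0_conv[symmetric] simp del: neq0_conv)
  then show ?case using Cons assms X_mult by simp
qed (use assms X_1 in simp)

lemma
  assumes p: "prime p"
  shows integrable_prime_power: "integrable M (\<lambda>\<omega>. X p \<omega> ^ a * cnj (X p \<omega>) ^ b)"
    and expectation_prime_power:
      "expectation (\<lambda>\<omega>. X p \<omega> ^ a * cnj (X p \<omega>) ^ b) = (if a = b then 1 else 0)"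
proof -
  let ?U = "uniform_measure lborel {0..2*pi}"
  define g where "g = (\<lambda>z::complex. z ^ a * cnj z ^ b)"
  have g[measurable]: "g \<in> borel_measurable borel"
    unfolding g_def by (intro borel_measurable_continuous_onI continuous_intros)
  have Xm[measurable]: "X p \<in> borel_measurable M" using p by simp
  have gcis: "g (cis t) = cis (of_int (int a - int b) * t)" for t
    unfolding g_def cis_cnj Complex.DeMoivre cis_mult by (rule arg_cong[of _ _ cis]) (simp add: algebra_simps)
  interpret U: prob_space ?U by (rule prob_space_uniform_measure) auto
  have "integrable ?U (\<lambda>t. g (cis t))"
    unfolding gcis by (intro U.integrable_const_bound[of _ 1])
      (auto intro!: AE_I2 borel_measurable_continuous_onI continuous_intros simp: uniform_measure_def)
  then have "integrable (distr ?U borel cis) g"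
    by (subst integrable_distr_eq) (auto simp: uniform_measure_def)
  then have "integrable (distr M borel (X p)) g" by (simp add: uniform_circle[OF p])
  then show "integrable M (\<lambda>\<omega>. X p \<omega> ^ a * cnj (X p \<omega>) ^ b)"
    using g by (subst (asm) integrable_distr_eq) (auto simp: g_def[abs_def])
  have "expectation (\<lambda>\<omega>. g (X p \<omega>)) = integral\<^sup>L (distr M borel (X p)) g"
    by (subst integral_distr) auto
  also have "\<dots> = integral\<^sup>L (distr ?U borel cis) g" by (simp add: uniform_circle[OF p])
  also have "\<dots> = (LINT t|?U. g (cis t))" by (subst integral_distr) (auto simp: uniform_measure_def)
  also have "\<dots> = (if a = b then 1 else 0)"
    unfolding gcis by (subst integral_cis_multiple) auto
  finally show "expectation (\<lambda>\<omega>. X p \<omega> ^ a * cnj (X p \<omega>) ^ b) = (if a = b then 1 else 0)"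
    by (simp add: g_def)
qed

text \<open>By independence the expectation factors over the primes of m and n; one prime with
  different multiplicities in m and n makes it vanish, and if there is none, m = n by unique
  factorization.\<close>

lemma
  assumes "m \<ge> 1" "n \<ge> 1"
  shows X_orthogonal_integrable: "integrable M (\<lambda>\<omega>. X m \<omega> * cnj (X n \<omega>))"
    and X_orthogonal: "expectation (\<lambda>\<omega>. X m \<omega> * cnj (X n \<omega>)) = (if m = n then 1 else 0)"
proof -
  define P where "P = prime_factors m \<union> prime_factors n"
  have P: "finite P" "\<And>p. p \<in> P \<Longrightarrow> prime p" by (auto simp: P_def)
  define Y where "Y = (\<lambda>p \<omega>. X p \<omega> ^ multiplicity p m * cnj (X p \<omega>) ^ multiplicity p n)"
  have eq: "X m \<omega> * cnj (X n \<omega>) = (\<Prod>p\<in>P. Y p \<omega>)" if "\<omega> \<in> space M" for \<omega>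
    using that assms by (subst (1 2) X_eq_prod[of P]) (auto simp: P_def Y_def prod.distrib)
  have "indep_vars (\<lambda>_. borel) X P"
    using indep_primes P by (intro indep_vars_subset[of _ X "{p. prime p}" P]) auto
  then have ind: "indep_vars (\<lambda>_. borel) Y P"
    unfolding Y_def
    by (rule indep_vars_compose2) (intro borel_measurable_continuous_onI continuous_intros)
  have int: "integrable M (Y p)" if "p \<in> P" for p
    unfolding Y_def using P that by (intro integrable_prime_power) auto
  show "integrable M (\<lambda>\<omega>. X m \<omega> * cnj (X n \<omega>))"
    using indep_vars_integrable[OF P(1) ind int] by (subst Bochner_Integration.integrable_cong[OF refl eq]) auto
  have "expectation (\<lambda>\<omega>. X m \<omega> * cnj (X n \<omega>)) = expectation (\<lambda>\<omega>. \<Prod>p\<in>P. Y p \<omega>)"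
    by (intro Bochner_Integration.integral_cong eq refl)
  also have "\<dots> = (\<Prod>p\<in>P. expectation (Y p))" using indep_vars_lebesgue_integral[OF P(1) ind int] .
  also have "\<dots> = (\<Prod>p\<in>P. if multiplicity p m = multiplicity p n then 1 else 0)"
    unfolding Y_def using P by (intro prod.cong refl expectation_prime_power) auto
  also have "\<dots> = (if m = n then 1 else 0)"
  proof (cases "m = n")
    case False
    have "\<exists>p\<in>P. multiplicity p m \<noteq> multiplicity p n"
    proof (rule ccontr)
      assume *: "\<not> ?thesis"
      have "multiplicity p m = multiplicity p n" if "prime p" for p
      proof (cases "p \<in> P")
        case True then show ?thesis using * by blast
      next
        case False
        then have "\<not> p dvd m" "\<not> p dvd n" using that assms by (auto simp: P_def in_prime_factors_iff)
        then show ?thesis by (simp add: not_dvd_imp_multiplicity_0)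
      qed
      with assms have "m = n" by (intro multiplicity_eq_nat[of m n]) simp_all
      then show False using False by simp
    qed
    then show ?thesis using False P(1) by auto
  qed simp
  finally show "expectation (\<lambda>\<omega>. X m \<omega> * cnj (X n \<omega>)) = (if m = n then 1 else 0)" .
qed

lemma moment_eq_card_product_pairs:
  assumes "finite A" "\<And>n. n \<in> A \<Longrightarrow> n \<ge> 1"
  shows "(LINT \<omega>|M. norm (\<Sum>n\<in>A. X n \<omega>) ^ (2 * k)) = real (card (product_pairs A k))"
proof -
  define L where "L = {ms. set ms \<subseteq> A \<and> length ms = k}"
  have L: "finite L" using assms by (simp add: L_def finite_lists_length_eq)
  have L1: "prod_list ms \<ge> 1" "\<forall>m\<in>set ms. m \<ge> 1" if "ms \<in> L" for ms
    using that assms(2) by (auto simp: L_def Suc_le_eq subset_iff prod_list_zero_iff neq0_conv[symmetric] simp del: neq0_conv)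
  have eq: "complex_of_real (norm (\<Sum>n\<in>A. X n \<omega>) ^ (2 * k))
      = (\<Sum>(ms, ns)\<in>L \<times> L. X (prod_list ms) \<omega> * cnj (X (prod_list ns) \<omega>))" if "\<omega> \<in> space M" for \<omega>
  proof -
    have "complex_of_real (norm (\<Sum>n\<in>A. X n \<omega>) ^ (2 * k)) = ((\<Sum>n\<in>A. X n \<omega>) * cnj (\<Sum>n\<in>A. X n \<omega>)) ^ k"
      unfolding power_mult of_real_power[of _ k] complex_norm_square by (rule refl)
    also have "\<dots> = (\<Sum>n\<in>A. X n \<omega>) ^ k * cnj ((\<Sum>n\<in>A. X n \<omega>) ^ k)"
      by (simp add: power_mult_distrib)
    also have "(\<Sum>n\<in>A. X n \<omega>) ^ k = (\<Sum>ms\<in>L. X (prod_list ms) \<omega>)"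
      unfolding sum_power_eq_sum_lists[OF assms(1)] L_def[symmetric]
      using that L1 by (intro sum.cong X_prod_list refl) auto
    finally show ?thesis by (simp add: sum_product sum.cartesian_product)
  qed
  have int: "integrable M (\<lambda>\<omega>. X (prod_list ms) \<omega> * cnj (X (prod_list ns) \<omega>))"
    if "ms \<in> L" "ns \<in> L" for ms ns using that L1 by (intro X_orthogonal_integrable) auto
  have "complex_of_real (LINT \<omega>|M. norm (\<Sum>n\<in>A. X n \<omega>) ^ (2 * k))
      = (LINT \<omega>|M. complex_of_real (norm (\<Sum>n\<in>A. X n \<omega>) ^ (2 * k)))"
    by (rule integral_complex_of_real[symmetric])
  also have "\<dots> = (LINT \<omega>|M. (\<Sum>(ms, ns)\<in>L \<times> L. X (prod_list ms) \<omega> * cnj (X (prod_list ns) \<omega>)))"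
    by (intro Bochner_Integration.integral_cong eq refl)
  also have "\<dots> = (\<Sum>(ms, ns)\<in>L \<times> L. if prod_list ms = prod_list ns then 1 else 0)"
    using int L1 by (subst Bochner_Integration.integral_sum) (auto intro!: sum.cong X_orthogonal)
  also have "\<dots> = of_nat (card {z \<in> L \<times> L. prod_list (fst z) = prod_list (snd z)})"
    using L by (subst card_eq_sum, subst sum.inter_filter) (auto intro!: sum.cong)
  also have "{z \<in> L \<times> L. prod_list (fst z) = prod_list (snd z)} = product_pairs A k"
    by (auto simp: product_pairs_def L_def)
  finally show ?thesis by (metis of_real_eq_iff of_real_of_nat_eq)
qed

end

text \<open>Pairs of tuples are sorted by their common product. This brings the middle term of the
  lower bound into the same form as the moments, so that they can be compared by inclusion of sets
  of pairs.\<close>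

lemma sum_restricted_divisor_sq:
  assumes "finite S"
  shows "(\<Sum>N\<in>S. real (restricted_divisor k N x) ^ 2)
    = real (card {(ms, ns) \<in> product_pairs (pos_upto x) k. prod_list ms \<in> S})"
proof -
  define R where "R = (\<lambda>N. {ms. length ms = k \<and> set ms \<subseteq> pos_upto x \<and> prod_list ms = N})"
  have fin: "finite (R N)" for N
    by (rule rev_finite_subset[OF finite_lists_length_eq[OF finite_pos_upto, of x k]]) (auto simp: R_def)
  have "{(ms, ns) \<in> product_pairs (pos_upto x) k. prod_list ms \<in> S} = (\<Union>N\<in>S. R N \<times> R N)"
    by (auto simp: product_pairs_def R_def)
  then have "card {(ms, ns) \<in> product_pairs (pos_upto x) k. prod_list ms \<in> S} = (\<Sum>N\<in>S. card (R N \<times> R N))"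
    using assms fin by (simp add: card_UN_disjoint R_def disjoint_iff)
  then show ?thesis
    by (simp add: card_cartesian_product restricted_divisor_def R_def power2_eq_square)
qed

section \<open>The upper bound\<close>

lemma dvd_prod_decompose:
  fixes g :: "'j \<Rightarrow> nat"
  assumes "finite J" "d dvd prod g J"
  shows "\<exists>e. (\<forall>j\<in>J. e j dvd g j) \<and> prod e J = d"
  using assms
proof (induction J arbitrary: d rule: finite_induct)
  case (insert j J)
  from insert.prems obtain b c where bc: "d = b * c" "b dvd g j" "c dvd prod g J"
    using division_decomp[of d "g j" "prod g J"] insert.hyps by auto
  from insert.IH[OF bc(3)] obtain e where e: "\<forall>j\<in>J. e j dvd g j" "prod e J = c" by blast
  have "prod (e(j := b)) J = prod e J" using insert.hyps by (intro prod.cong) auto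
  then show ?case using bc e insert.hyps by (intro exI[of _ "e(j := b)"]) auto
qed simp

text \<open>Row by row: \<open>f i\<close> divides the product of the \<open>g j\<close>, hence
  splits into divisors \<open>e j\<close> of the \<open>g j\<close>. These form row i, and the other
  rows refine the quotients \<open>g j div e j\<close>.\<close>

lemma product_refinement:
  fixes f :: "'i \<Rightarrow> nat" and g :: "'j \<Rightarrow> nat"
  assumes "finite I" "finite J" "\<And>i. i \<in> I \<Longrightarrow> f i > 0" "\<And>j. j \<in> J \<Longrightarrow> g j > 0" "prod f I = prod g J"
  shows "\<exists>a. (\<forall>i\<in>I. (\<Prod>j\<in>J. a i j) = f i) \<and> (\<forall>j\<in>J. (\<Prod>i\<in>I. a i j) = g j)"
  using assms(1,3-5)
proof (induction I arbitrary: g rule: finite_induct)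
  case empty
  then have "prod g J = 1" by simp
  then have "g j = 1" if "j \<in> J" for j
    using dvd_prodI[OF assms(2) that, of g] by simp
  then show ?case by simp
next
  case (insert i I)
  have "f i dvd prod g J" using insert.prems(3) insert.hyps by (metis dvd_triv_left prod.insert)
  then obtain e where e: "\<forall>j\<in>J. e j dvd g j" "prod e J = f i"
    using dvd_prod_decompose[OF assms(2)] by blast
  define g' where "g' = (\<lambda>j. g j div e j)"
  have g': "e j * g' j = g j" if "j \<in> J" for j using e that by (simp add: g'_def)
  have "f i * prod f I = prod (\<lambda>j. e j * g' j) J"
    using insert.prems(3) insert.hyps g' by (simp cong: prod.cong)
  then have "f i * prod f I = f i * prod g' J" using e by (simp add: prod.distrib)
  then have "prod f I = prod g' J" using insert.prems(1)[of i] by simp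
  moreover have "g' j > 0" if "j \<in> J" for j using g'[OF that] insert.prems(2)[OF that] by (metis gr0I mult_0_right)
  ultimately obtain a where a: "\<forall>i\<in>I. (\<Prod>j\<in>J. a i j) = f i" "\<forall>j\<in>J. (\<Prod>i\<in>I. a i j) = g' j"
    using insert.IH[of g'] insert.prems by auto
  have "(\<Prod>l\<in>I. (a(i := e)) l j) = (\<Prod>l\<in>I. a l j)" for j
    using insert.hyps by (intro prod.cong) auto
  then show ?case using a e g' insert.hyps by (intro exI[of _ "a(i := e)"]) auto
qed

text \<open>The row and column products are bounded instead of prescribed, so that one set of
  matrices serves all pairs of tuples.\<close>

definition product_matrices :: "nat \<Rightarrow> real \<Rightarrow> (nat \<times> nat \<Rightarrow> nat) set" where
  "product_matrices k x = {a \<in> ({..<k} \<times> {..<k}) \<rightarrow>\<^sub>E {0<..}.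
     (\<forall>i<k. real (\<Prod>j<k. a (i, j)) \<le> x) \<and> (\<forall>j<k. real (\<Prod>i<k. a (i, j)) \<le> x)}"

definition sum_matrices :: "nat \<Rightarrow> nat \<Rightarrow> (nat \<times> nat \<Rightarrow> nat) set" where
  "sum_matrices k B = {v \<in> ({..<k} \<times> {..<k}) \<rightarrow>\<^sub>E {..B}.
     (\<forall>i<k. (\<Sum>j<k. v (i, j)) \<le> B) \<and> (\<forall>j<k. (\<Sum>i<k. v (i, j)) \<le> B)}"

lemma finite_sum_matrices: "finite (sum_matrices k B)"
proof (rule finite_subset)
  show "sum_matrices k B \<subseteq> ({..<k} \<times> {..<k}) \<rightarrow>\<^sub>E {..B}" unfolding sum_matrices_def by blast
  show "finite (({..<k} \<times> {..<k}) \<rightarrow>\<^sub>E {..B})" by (rule finite_PiE) auto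
qed

lemma product_matrices_entry_le:
  assumes a: "a \<in> product_matrices k x" and ij: "i < k" "j < k"
  shows "a (i, j) > 0" "real (a (i, j)) \<le> x"
proof -
  have pos: "a (i, j) > 0" if "i < k" "j < k" for i j
    using a that by (auto simp: product_matrices_def PiE_def Pi_def)
  then show "a (i, j) > 0" using ij .
  have "a (i, j) dvd (\<Prod>j<k. a (i, j))" using ij by (intro dvd_prodI[of _ _ "\<lambda>j. a (i, j)"]) auto
  then have "a (i, j) \<le> (\<Prod>j<k. a (i, j))" using pos ij by (intro dvd_imp_le prod_pos) auto
  then have "real (a (i, j)) \<le> real (\<Prod>j<k. a (i, j))" by (rule of_nat_mono)
  also have "\<dots> \<le> x" using a ij by (simp only: product_matrices_def mem_Collect_eq)
  finally show "real (a (i, j)) \<le> x" .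
qed

lemma finite_product_matrices: "finite (product_matrices k x)"
proof (rule finite_subset)
  show "product_matrices k x \<subseteq> ({..<k} \<times> {..<k}) \<rightarrow>\<^sub>E {..nat \<lfloor>x\<rfloor>}"
  proof
    fix a assume a: "a \<in> product_matrices k x"
    show "a \<in> ({..<k} \<times> {..<k}) \<rightarrow>\<^sub>E {..nat \<lfloor>x\<rfloor>}"
    proof (rule PiE_I)
      fix z assume "z \<in> {..<k} \<times> {..<k}"
      then show "a z \<in> {..nat \<lfloor>x\<rfloor>}"
        using product_matrices_entry_le(2)[OF a] by (cases z) (simp add: le_nat_floor)
    next
      fix z assume "z \<notin> {..<k} \<times> {..<k}"
      then show "a z = undefined" using a unfolding product_matrices_def by blast
    qed
  qed
  show "finite (({..<k} \<times> {..<k}) \<rightarrow>\<^sub>E {..nat \<lfloor>x\<rfloor>})" by (rule finite_PiE) auto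
qed

text \<open>By \<open>product_refinement\<close>, taking row and column products is a map from
  matrices that reaches every pair. Different matrices may give the same pair, which is why this is
  an inequality.\<close>

lemma card_product_pairs_le_matrices:
  "card (product_pairs (pos_upto x) k) \<le> card (product_matrices k x)"
proof (rule surj_card_le[OF finite_product_matrices])
  let ?\<Phi> = "\<lambda>a. (map (\<lambda>i. \<Prod>j<k. a (i, j)) [0..<k], map (\<lambda>j. \<Prod>i<k. a (i, j)) [0..<k])"
  show "product_pairs (pos_upto x) k \<subseteq> ?\<Phi> ` product_matrices k x"
  proof
    fix z assume z: "z \<in> product_pairs (pos_upto x) k"
    obtain ms ns where zeq: "z = (ms, ns)" by (cases z)
    have len: "length ms = k" "length ns = k" and eq: "prod_list ms = prod_list ns"
      and sub: "set ms \<subseteq> pos_upto x" "set ns \<subseteq> pos_upto x"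
      using z by (auto simp: zeq product_pairs_def)
    have bd: "ms ! i > 0" "ns ! i > 0" "real (ms ! i) \<le> x" "real (ns ! i) \<le> x" if "i < k" for i
    proof -
      have "ms ! i \<in> pos_upto x" "ns ! i \<in> pos_upto x"
        using sub len that by (auto intro!: subsetD[OF _ nth_mem])
      then show "ms ! i > 0" "ns ! i > 0" "real (ms ! i) \<le> x" "real (ns ! i) \<le> x"
        by (auto simp: pos_upto_def)
    qed
    have prodeq: "prod_list xs = (\<Prod>i<k. xs ! i)" if "length xs = k" for xs :: "nat list"
      using that by (simp add: prod.list_conv_set_nth atLeast0LessThan)
    have "\<exists>a. (\<forall>i\<in>{..<k}. (\<Prod>j<k. a i j) = ms ! i) \<and> (\<forall>j\<in>{..<k}. (\<Prod>i<k. a i j) = ns ! j)"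
      using bd eq len prodeq by (intro product_refinement) auto
    then obtain a where a: "\<And>i. i < k \<Longrightarrow> (\<Prod>j<k. a i j) = ms ! i" "\<And>j. j < k \<Longrightarrow> (\<Prod>i<k. a i j) = ns ! j"
      by auto
    define a' where "a' = restrict (\<lambda>(i, j). a i j) ({..<k} \<times> {..<k})"
    have a': "(\<Prod>j<k. a' (i, j)) = ms ! i" "(\<Prod>j<k. a' (j, i)) = ns ! i" if "i < k" for i
      using a[OF that] that by (simp_all add: a'_def cong: prod.cong_simp)
    have "a i j > 0" if "i < k" "j < k" for i j
    proof (rule ccontr)
      assume "\<not> a i j > 0"
      then have "(\<Prod>j<k. a i j) = 0" using that by auto
      then show False using a(1)[OF that(1)] bd(1)[OF that(1)] by simp
    qed
    then have "a' \<in> ({..<k} \<times> {..<k}) \<rightarrow>\<^sub>E {0<..}" by (auto simp: a'_def)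
    moreover have "\<forall>i<k. real (\<Prod>j<k. a' (i, j)) \<le> x" "\<forall>j<k. real (\<Prod>i<k. a' (i, j)) \<le> x"
      using a' bd(3,4) by (simp_all del: of_nat_prod)
    ultimately have "a' \<in> product_matrices k x" by (simp only: product_matrices_def mem_Collect_eq)
    moreover have "map (\<lambda>i. \<Prod>j<k. a' (i, j)) [0..<k] = ms" "map (\<lambda>j. \<Prod>i<k. a' (i, j)) [0..<k] = ns"
      by (rule nth_equalityI; use a' len in simp)+
    then have "z = ?\<Phi> a'" by (simp only: zeq)
    ultimately show "z \<in> ?\<Phi> ` product_matrices k x" by blast
  qed
qed

section \<open>Rounded logarithms and the exponential sum over integer matrices\<close>

lemma card_nat_floor_ln_eq:
  "finite {n. 0 < n \<and> nat \<lfloor>ln (real n)\<rfloor> = v}" "real (card {n. 0 < n \<and> nat \<lfloor>ln (real n)\<rfloor> = v}) \<le> exp (real v + 1)"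
proof -
  let ?S = "{n. 0 < n \<and> nat \<lfloor>ln (real n)\<rfloor> = v}"
  have sub: "?S \<subseteq> {0<..nat \<lfloor>exp (real v + 1)\<rfloor>}"
  proof
    fix n assume n: "n \<in> ?S"
    then have "ln (real n) \<le> real v + 1" by auto
    then have "real n \<le> exp (real v + 1)" using n by (metis (mono_tags) exp_le_cancel_iff exp_ln mem_Collect_eq of_nat_0_less_iff)
    then show "n \<in> {0<..nat \<lfloor>exp (real v + 1)\<rfloor>}" using n by (auto simp: le_nat_floor)
  qed
  then show "finite ?S" by (rule finite_subset) simp
  have "card ?S \<le> nat \<lfloor>exp (real v + 1)\<rfloor>" using card_mono[OF _ sub] by simp
  moreover have "real (nat \<lfloor>exp (real v + 1)\<rfloor>) \<le> exp (real v + 1)" by (simp add: of_nat_floor)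
  ultimately show "real (card ?S) \<le> exp (real v + 1)" by linarith
qed

text \<open>Matrices are sorted by the integer parts of the logarithms of their entries. Each fibre
  lies in a box with at most exp(v + 1) choices for an entry with integer part v; the summands 1
  produce exp(k^2).\<close>

lemma card_product_matrices_le:
  assumes x: "x \<ge> 1"
  shows "real (card (product_matrices k x))
    \<le> exp (real (k\<^sup>2)) * (\<Sum>v\<in>sum_matrices k (nat \<lfloor>ln x\<rfloor>). exp (\<Sum>i<k. \<Sum>j<k. real (v (i, j))))"
proof -
  let ?I = "{..<k} \<times> {..<k}" and ?B = "nat \<lfloor>ln x\<rfloor>"
  define lf where "lf = (\<lambda>a. restrict (\<lambda>z. nat \<lfloor>ln (real (a z))\<rfloor>) ?I :: nat \<times> nat \<Rightarrow> nat)"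
  \<comment> \<open>The sum of the integer parts is an integer that is at most ln x, hence at most
    the integer part of ln x.\<close>
  have lesum: "(\<Sum>i<k. nat \<lfloor>ln (real (f i))\<rfloor>) \<le> ?B" if "\<And>i. i < k \<Longrightarrow> f i > 0" "real (\<Prod>i<k. f i) \<le> x" for f :: "nat \<Rightarrow> nat"
  proof -
    have "real (\<Sum>i<k. nat \<lfloor>ln (real (f i))\<rfloor>) \<le> (\<Sum>i<k. ln (real (f i)))"
      unfolding of_nat_sum using that by (intro sum_mono) (simp add: Suc_le_eq)
    also have "\<dots> = ln (\<Prod>i<k. real (f i))" using that by (intro ln_prod[symmetric]) auto
    also have "\<dots> \<le> ln x" using that x by (subst ln_le_cancel_iff) (auto intro!: prod_pos)
    finally show ?thesis by (simp add: le_nat_floor)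
  qed
  have img: "lf ` product_matrices k x \<subseteq> sum_matrices k ?B"
  proof
    fix v assume "v \<in> lf ` product_matrices k x"
    then obtain a where a: "a \<in> product_matrices k x" "v = lf a" by blast
    note pos = product_matrices_entry_le(1)[OF a(1)]
    have "(\<Sum>j<k. v (i, j)) \<le> ?B" "(\<Sum>j<k. v (j, i)) \<le> ?B" if "i < k" for i
    proof -
      have "(\<Sum>j<k. v (i, j)) = (\<Sum>j<k. nat \<lfloor>ln (real (a (i, j)))\<rfloor>)"
        "(\<Sum>j<k. v (j, i)) = (\<Sum>j<k. nat \<lfloor>ln (real (a (j, i)))\<rfloor>)"
        using that by (auto simp: a(2) lf_def)
      then show "(\<Sum>j<k. v (i, j)) \<le> ?B" "(\<Sum>j<k. v (j, i)) \<le> ?B"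
        using a(1) that pos by (auto simp: product_matrices_def simp del: of_nat_prod intro!: lesum)
    qed
    moreover have "v (i, j) \<le> ?B" if "i < k" "j < k" for i j
      using product_matrices_entry_le[OF a(1) that] that x
      by (auto simp: a(2) lf_def intro!: nat_mono floor_mono)
    ultimately show "v \<in> sum_matrices k ?B"
      by (auto simp: sum_matrices_def a(2) lf_def)
  qed
  have "real (card (product_matrices k x)) = (\<Sum>a\<in>product_matrices k x. 1)" by simp
  also have "\<dots> = (\<Sum>v\<in>lf ` product_matrices k x. \<Sum>a | a \<in> product_matrices k x \<and> lf a = v. 1)"
    by (rule sum.image_gen[OF finite_product_matrices])
  also have "\<dots> \<le> (\<Sum>v\<in>sum_matrices k ?B. \<Sum>a | a \<in> product_matrices k x \<and> lf a = v. 1)"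
    by (rule sum_mono2[OF finite_sum_matrices img]) simp
  also have "\<dots> \<le> (\<Sum>v\<in>sum_matrices k ?B. exp (real (k\<^sup>2)) * exp (\<Sum>i<k. \<Sum>j<k. real (v (i, j))))"
  proof (rule sum_mono)
    fix v assume "v \<in> sum_matrices k ?B"
    let ?F = "{a. a \<in> product_matrices k x \<and> lf a = v}"
    let ?T = "\<lambda>z. {n. 0 < n \<and> nat \<lfloor>ln (real n)\<rfloor> = v z}"
    have "?F \<subseteq> Pi\<^sub>E ?I ?T"
      by (auto simp: product_matrices_def lf_def PiE_def Pi_def)
    then have "card ?F \<le> card (Pi\<^sub>E ?I ?T)"
      by (intro card_mono finite_PiE) (auto simp: card_nat_floor_ln_eq(1))
    then have "(\<Sum>a\<in>?F. 1::real) \<le> real (card (Pi\<^sub>E ?I ?T))" by simp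
    also have "\<dots> = (\<Prod>z\<in>?I. real (card (?T z)))" by (simp add: card_PiE)
    also have "\<dots> \<le> (\<Prod>z\<in>?I. exp (real (v z) + 1))" by (intro prod_mono) (simp add: card_nat_floor_ln_eq(2))
    also have "\<dots> = exp (\<Sum>z\<in>?I. real (v z) + 1)" by (simp add: exp_sum)
    also have "(\<Sum>z\<in>?I. real (v z) + 1) = real (k\<^sup>2) + (\<Sum>i<k. \<Sum>j<k. real (v (i, j)))"
      by (simp add: sum.distrib sum.cartesian_product power2_eq_square)
    finally show "(\<Sum>a\<in>?F. 1::real) \<le> exp (real (k\<^sup>2)) * exp (\<Sum>i<k. \<Sum>j<k. real (v (i, j)))"
      by (simp add: exp_add)
  qed
  finally show ?thesis by (simp add: sum_distrib_left)
qed

lemma sum_exp_half_le: "(\<Sum>s\<le>B. exp (real s / 2)) \<le> 4 * exp (real B / 2)"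
proof (induction B)
  case (Suc B)
  have "3/2 \<le> exp (1/2::real)" using exp_ge_add_one_self[of "1/2::real"] by simp
  then have "4 * exp (real B / 2) \<le> 3 * exp (real B / 2) * exp (1/2)" by simp
  also have "\<dots> = 3 * exp (real (Suc B) / 2)" by (simp add: exp_add[symmetric] field_simps)
  finally show ?case using Suc by simp
qed simp

lemma sum_exp_neg_le:
  assumes "r > 0"
  shows "(\<Sum>b\<le>B. exp (- r * real b)) \<le> 1 + 1 / r"
proof -
  have "exp (- r) \<le> 1 / (1 + r)"
    using exp_ge_add_one_self[of r] assms by (simp add: exp_minus field_simps)
  then have rr: "1 - exp (- r) \<ge> r / (1 + r)" using assms by (simp add: field_simps)
  have "(1 - exp (- r)) * (\<Sum>b\<le>B. exp (- r) ^ b) = 1 - exp (- r) ^ Suc B"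
    using sum_gp_basic[of "exp (- r)" B] by simp
  also have "\<dots> \<le> 1" by simp
  finally have le: "(1 - exp (- r)) * (\<Sum>b\<le>B. exp (- r) ^ b) \<le> 1" .
  have "r / (1 + r) * (\<Sum>b\<le>B. exp (- r) ^ b) \<le> (1 - exp (- r)) * (\<Sum>b\<le>B. exp (- r) ^ b)"
    using rr by (intro mult_right_mono sum_nonneg) auto
  then have "r / (1 + r) * (\<Sum>b\<le>B. exp (- r) ^ b) \<le> 1" using le by linarith
  then have "(\<Sum>b\<le>B. exp (- r) ^ b) \<le> (1 + r) / r" using assms by (simp add: field_simps)
  then show ?thesis using assms by (simp add: exp_of_nat_mult[symmetric] mult.commute add_divide_distrib)
qed

text \<open>The row sums recover the last column of the first m rows; after that the column sums
  recover the last row, corner included.\<close>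

lemma sum_matrices_inj:
  "inj_on (\<lambda>v. (restrict v ({..<m} \<times> {..<m}), restrict (\<lambda>i. \<Sum>j<Suc m. v (i, j)) {..<Suc m},
      restrict (\<lambda>j. \<Sum>i<Suc m. v (i, j)) {..<Suc m})) (sum_matrices (Suc m) B)"
proof (rule inj_onI)
  fix v w assume v: "v \<in> sum_matrices (Suc m) B" and w: "w \<in> sum_matrices (Suc m) B"
    and eq: "(restrict v ({..<m} \<times> {..<m}), restrict (\<lambda>i. \<Sum>j<Suc m. v (i, j)) {..<Suc m},
        restrict (\<lambda>j. \<Sum>i<Suc m. v (i, j)) {..<Suc m})
      = (restrict w ({..<m} \<times> {..<m}), restrict (\<lambda>i. \<Sum>j<Suc m. w (i, j)) {..<Suc m},
        restrict (\<lambda>j. \<Sum>i<Suc m. w (i, j)) {..<Suc m})"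
  note b = conjunct1[OF eq[unfolded prod.inject]]
    and s = conjunct1[OF conjunct2[OF eq[unfolded prod.inject]]]
    and t = conjunct2[OF conjunct2[OF eq[unfolded prod.inject]]]
  have block: "v (i, j) = w (i, j)" if "i < m" "j < m" for i j
    using fun_cong[OF b, of "(i, j)"] that by simp
  have row: "(\<Sum>j<m. v (i, j)) + v (i, m) = (\<Sum>j<m. w (i, j)) + w (i, m)" if "i < Suc m" for i
    using fun_cong[OF s, of i] that by simp
  have col: "(\<Sum>i<m. v (i, j)) + v (m, j) = (\<Sum>i<m. w (i, j)) + w (m, j)" if "j < Suc m" for j
    using fun_cong[OF t, of j] that by simp
  have rows: "v (i, j) = w (i, j)" if "i < m" "j < Suc m" for i j
  proof (cases "j < m")
    case False
    have "(\<Sum>j<m. v (i, j)) = (\<Sum>j<m. w (i, j))" using that block by (intro sum.cong) auto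
    then show ?thesis using row[of i] that False by (simp add: less_Suc_eq)
  qed (use that block in auto)
  have last: "v (m, j) = w (m, j)" if "j < Suc m" for j
  proof -
    have "(\<Sum>i<m. v (i, j)) = (\<Sum>i<m. w (i, j))" using that rows by (intro sum.cong) auto
    then show ?thesis using col[OF that] by simp
  qed
  show "v = w"
  proof (rule PiE_ext)
    show "v \<in> ({..<Suc m} \<times> {..<Suc m}) \<rightarrow>\<^sub>E {..B}" "w \<in> ({..<Suc m} \<times> {..<Suc m}) \<rightarrow>\<^sub>E {..B}"
      using v w by (auto simp: sum_matrices_def)
    fix z assume "z \<in> {..<Suc m} \<times> {..<Suc m}"
    then show "v z = w z" using rows last by (cases z) (auto simp: less_Suc_eq)
  qed
qed

text \<open>
  The exponent is split evenly between the row sums and the column sums, and the condition on the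
  block is relaxed by Rankin's trick, with weight \<open>exp (r * (m * B - s)) \<ge> 1\<close> for block sum \<open>s\<close>.
\<close>

lemma sum_exp_sum_matrices_le:
  assumes l: "r > 0"
  shows "(\<Sum>v\<in>sum_matrices (Suc m) B. exp (\<Sum>i<Suc m. \<Sum>j<Suc m. real (v (i, j))))
    \<le> exp (r * real (m * B)) * (1 + 1 / r) ^ m\<^sup>2 * (4 * exp (real B / 2)) ^ (2 * Suc m)"
proof -
  let ?J = "{..<m} \<times> {..<m}" and ?I = "{..<Suc m}"
  define mg where "mg = (\<lambda>v. (restrict v ?J, restrict (\<lambda>i. \<Sum>j<Suc m. v (i, j)) ?I,
      restrict (\<lambda>j. \<Sum>i<Suc m. v (i, j)) ?I) :: (nat \<times> nat \<Rightarrow> nat) \<times> (nat \<Rightarrow> nat) \<times> (nat \<Rightarrow> nat))"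
  define G :: "(nat \<times> nat \<Rightarrow> nat) \<times> (nat \<Rightarrow> nat) \<times> (nat \<Rightarrow> nat) \<Rightarrow> real"
    where "G = (\<lambda>(b, s, t). (\<Prod>z\<in>?J. exp (- r * real (b z))) *
      ((\<Prod>i\<in>?I. exp (real (s i) / 2)) * (\<Prod>j\<in>?I. exp (real (t j) / 2))))"
  define S where "S = (?J \<rightarrow>\<^sub>E {..B}) \<times> (?I \<rightarrow>\<^sub>E {..B}) \<times> (?I \<rightarrow>\<^sub>E {..B})"
  have finS: "finite S" unfolding S_def by (intro finite_cartesian_product finite_PiE) auto
  have "(\<Sum>v\<in>sum_matrices (Suc m) B. exp (\<Sum>i\<in>?I. \<Sum>j\<in>?I. real (v (i, j))))
      \<le> (\<Sum>v\<in>sum_matrices (Suc m) B. exp (r * real (m * B)) * G (mg v))"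
  proof (rule sum_mono)
    fix v assume v: "v \<in> sum_matrices (Suc m) B"
    let ?s = "\<lambda>i. \<Sum>j\<in>?I. v (i, j)" and ?t = "\<lambda>j. \<Sum>i\<in>?I. v (i, j)"
    have "(\<Sum>i<m. \<Sum>j<m. v (i, j)) \<le> (\<Sum>i<m. B)"
    proof (rule sum_mono)
      fix i assume "i \<in> {..<m}"
      then have "(\<Sum>j\<in>?I. v (i, j)) \<le> B" using v by (auto simp: sum_matrices_def simp del: sum.lessThan_Suc)
      then show "(\<Sum>j<m. v (i, j)) \<le> B" by simp
    qed
    then have block: "(\<Sum>z\<in>?J. v z) \<le> m * B" by (simp add: sum.cartesian_product)
    have tot: "real (\<Sum>i\<in>?I. ?s i) = real (\<Sum>j\<in>?I. ?t j)" by (subst sum.swap) simp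
    have G: "G (mg v) = exp (- r * real (\<Sum>z\<in>?J. v z) + (real (\<Sum>i\<in>?I. ?s i) / 2 + real (\<Sum>j\<in>?I. ?t j) / 2))"
    proof -
      have "(\<Prod>z\<in>?J. exp (- r * real (restrict v ?J z))) = exp (- r * real (\<Sum>z\<in>?J. v z))"
        by (subst of_nat_sum, subst sum_distrib_left, subst exp_sum) (auto intro!: prod.cong)
      moreover have "(\<Prod>i\<in>?I. exp (real (restrict f ?I i) / 2)) = exp (real (\<Sum>i\<in>?I. f i) / 2)" for f
        by (subst of_nat_sum, subst sum_divide_distrib, subst exp_sum) (auto intro!: prod.cong)
      ultimately show ?thesis unfolding G_def mg_def by (simp only: prod.case exp_add)
    qed
    have eq: "(\<Sum>i\<in>?I. \<Sum>j\<in>?I. real (v (i, j))) = real (\<Sum>i\<in>?I. ?s i)" by (simp only: of_nat_sum)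
    have "r * real (\<Sum>z\<in>?J. v z) \<le> r * real (m * B)"
      using block l by (intro mult_left_mono of_nat_mono) auto
    then show "exp (\<Sum>i\<in>?I. \<Sum>j\<in>?I. real (v (i, j))) \<le> exp (r * real (m * B)) * G (mg v)"
      unfolding G eq exp_add[symmetric] exp_le_cancel_iff using tot by linarith
  qed
  also have "\<dots> = exp (r * real (m * B)) * (\<Sum>z\<in>mg ` sum_matrices (Suc m) B. G z)"
    using sum_matrices_inj[of m B] by (simp add: sum.reindex mg_def sum_distrib_left)
  also have "(\<Sum>z\<in>mg ` sum_matrices (Suc m) B. G z) \<le> (\<Sum>z\<in>S. G z)"
  proof (rule sum_mono2[OF finS])
    show "mg ` sum_matrices (Suc m) B \<subseteq> S"
      by (auto simp: mg_def S_def sum_matrices_def PiE_def Pi_def simp del: sum.lessThan_Suc)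
  qed (auto simp: G_def intro!: mult_nonneg_nonneg prod_nonneg)
  \<comment> \<open>On the product set \<open>S\<close> the weight \<open>G\<close> is a product
    over single coordinates, so the sum splits into m^2 geometric sums with ratio exp(-r) and 2(m +
    1) geometric sums with ratio exp(1/2).\<close>
  also have "(\<Sum>z\<in>S. G z) = (\<Sum>b\<in>?J \<rightarrow>\<^sub>E {..B}. \<Prod>z\<in>?J. exp (- r * real (b z))) *
      ((\<Sum>s\<in>?I \<rightarrow>\<^sub>E {..B}. \<Prod>i\<in>?I. exp (real (s i) / 2)) * (\<Sum>s\<in>?I \<rightarrow>\<^sub>E {..B}. \<Prod>i\<in>?I. exp (real (s i) / 2)))"
    unfolding S_def G_def
    by (simp only: sum.cartesian_product[symmetric] sum_product[symmetric] sum_distrib_left[symmetric] sum_distrib_right[symmetric])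
  also have "(\<Sum>b\<in>?J \<rightarrow>\<^sub>E {..B}. \<Prod>z\<in>?J. exp (- r * real (b z))) = (\<Sum>b\<le>B. exp (- r * real b)) ^ m\<^sup>2"
    by (subst prod_sum_PiE[symmetric]) (auto simp: power2_eq_square)
  also have "(\<Sum>s\<in>?I \<rightarrow>\<^sub>E {..B}. \<Prod>i\<in>?I. exp (real (s i) / 2)) = (\<Sum>s\<le>B. exp (real s / 2)) ^ Suc m"
    by (subst prod_sum_PiE[symmetric]) (auto simp: simp del: prod.lessThan_Suc)
  also have "(\<Sum>b\<le>B. exp (- r * real b)) ^ m\<^sup>2 * ((\<Sum>s\<le>B. exp (real s / 2)) ^ Suc m * (\<Sum>s\<le>B. exp (real s / 2)) ^ Suc m)
      = (\<Sum>b\<le>B. exp (- r * real b)) ^ m\<^sup>2 * (\<Sum>s\<le>B. exp (real s / 2)) ^ (2 * Suc m)"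
    by (simp only: power_add[symmetric] mult_2)
  also have "\<dots> \<le> (1 + 1 / r) ^ m\<^sup>2 * (4 * exp (real B / 2)) ^ (2 * Suc m)"
    using l by (intro mult_mono power_mono sum_exp_half_le sum_exp_neg_le)
      (auto intro!: sum_nonneg mult_nonneg_nonneg zero_le_power)
  finally show ?thesis by (simp add: mult.assoc)
qed

lemma card_product_pairs_le:
  assumes x: "x \<ge> 1" and k: "k \<ge> 1" and l: "r > 0"
  shows "real (card (product_pairs (pos_upto x) k))
    \<le> exp (real (k\<^sup>2)) * (exp (r * (real (k - 1) * ln x)) * (1 + 1 / r) ^ (k - 1)\<^sup>2 * (16 * x) ^ k)"
proof -
  obtain m where m: "k = Suc m" using k by (cases k) auto
  let ?B = "nat \<lfloor>ln x\<rfloor>"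
  have B: "real ?B \<le> ln x" using x by simp
  have "real (card (product_pairs (pos_upto x) k)) \<le> real (card (product_matrices k x))"
    using card_product_pairs_le_matrices by simp
  also have "\<dots> \<le> exp (real (k\<^sup>2)) * (\<Sum>v\<in>sum_matrices k ?B. exp (\<Sum>i<k. \<Sum>j<k. real (v (i, j))))"
    using card_product_matrices_le[OF x] .
  also have "\<dots> \<le> exp (real (k\<^sup>2)) * (exp (r * real (m * ?B)) * (1 + 1 / r) ^ m\<^sup>2 * (4 * exp (real ?B / 2)) ^ (2 * Suc m))"
    unfolding m using sum_exp_sum_matrices_le[OF l] by (intro mult_left_mono) auto
  also have "(4 * exp (real ?B / 2)) ^ (2 * Suc m) = (16 * exp (real ?B)) ^ k"
    by (simp only: power_mult power_mult_distrib m) (simp add: power_mult_distrib exp_add[symmetric] power2_eq_square)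
  also have "exp (real (k\<^sup>2)) * (exp (r * real (m * ?B)) * (1 + 1 / r) ^ m\<^sup>2 * (16 * exp (real ?B)) ^ k)
      \<le> exp (real (k\<^sup>2)) * (exp (r * (real m * ln x)) * (1 + 1 / r) ^ m\<^sup>2 * (16 * x) ^ k)"
  proof (intro mult_left_mono mult_mono power_mono)
    show "exp (real ?B) \<le> x" using B x by (metis exp_le_cancel_iff exp_ln less_le_trans zero_less_one)
    show "exp (r * real (m * ?B)) \<le> exp (r * (real m * ln x))"
      using B l by (simp add: mult_left_mono)
  qed (use x l in auto)
  finally show ?thesis by (simp add: m)
qed

text \<open>The size condition on x enters, for k >= 2, through ln x >= k, which follows from e ln 2
  >= 1. It makes 1 + 1/r at most 2 ln x / k for the choice r = k / ln x.\<close>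

lemma card_product_pairs_pos_upto_le:
  assumes k: "k \<ge> 1" and x: "x \<ge> real k powr (exp 1 * real k)"
  shows "real (card (product_pairs (pos_upto x) k)) \<le> x ^ k * (ln x / real k) ^ (k - 1)\<^sup>2 * exp (7 * real (k\<^sup>2))"
proof -
  have x1: "x \<ge> 1" using x k ge_one_powr_ge_zero[of "real k" "exp 1 * real k"] by simp
  have e2: "exp 1 \<ge> (2::real)" using exp_ge_add_one_self[of "1::real"] by simp
  have "(16::real) = 2 ^ 4" by simp
  also have "\<dots> \<le> exp 1 ^ 4" using e2 by (intro power_mono) auto
  also have "\<dots> = exp 4" by (simp flip: exp_of_nat_mult)
  finally have "(16::real) ^ k \<le> exp 4 ^ k" by (intro power_mono) auto
  also have "\<dots> = exp (real k * 4)" by (simp add: exp_of_nat_mult)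
  also have "\<dots> \<le> exp (4 * real (k\<^sup>2))" using k by (simp add: power2_eq_square)
  finally have c16: "(16::real) ^ k \<le> exp (4 * real (k\<^sup>2))" .
  show ?thesis
  \<comment> \<open>For k = 1 the logarithm of x may be 0, which rules out r = k / ln x. The power
    with exponent (k - 1)^2 = 0 is then 1, and r = 1 does.\<close>
  proof (cases "k = 1")
    case True
    have "real (card (product_pairs (pos_upto x) k)) \<le> exp 1 * (16 * x)"
      using card_product_pairs_le[OF x1 k, of 1] True by simp
    also have "\<dots> \<le> exp 1 * (exp 4 * x)" using c16 True x1 by simp
    also have "\<dots> = exp 5 * x" by (simp flip: exp_add)
    also have "\<dots> \<le> exp 7 * x" using x1 by simp
    finally show ?thesis using True by (simp add: mult.commute)
  next
    case False
    then have k2: "k \<ge> 2" using k by simp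
    have "ln x \<ge> exp 1 * real k * ln (real k)"
    proof -
      have "ln (real k powr (exp 1 * real k)) \<le> ln x" using x k x1 by (subst ln_le_cancel_iff) auto
      then show ?thesis using k by (simp add: ln_powr)
    qed
    moreover have "exp 1 * ln (real k) \<ge> 1"
    proof -
      have "ln 2 \<le> ln (real k)" using k2 by (subst ln_le_cancel_iff) auto
      then have "ln (real k) \<ge> 1 / 2" using ln2_ge_two_thirds by linarith
      then have "exp 1 * ln (real k) \<ge> 2 * (1 / 2)" using e2 by (intro mult_mono) auto
      then show ?thesis by simp
    qed
    ultimately have Lk: "ln x \<ge> real k"
      using mult_left_mono[of 1 "exp 1 * ln (real k)" "real k"] by (simp add: mult_ac)
    then have Lpos: "ln x > 0" using k by linarith
    \<comment> \<open>This balances the two Rankin factors: the weight becomes exp(k (k - 1)), while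
      1/r is exactly ln x / k.\<close>
    define r where "r = real k / ln x"
    have l: "r > 0" using Lpos k by (simp add: r_def)
    have "real (card (product_pairs (pos_upto x) k))
      \<le> exp (real (k\<^sup>2)) * (exp (r * (real (k - 1) * ln x)) * (1 + 1 / r) ^ (k - 1)\<^sup>2 * (16 * x) ^ k)"
      by (rule card_product_pairs_le[OF x1 k l])
    also have "r * (real (k - 1) * ln x) = real k * real (k - 1)" using Lpos by (simp add: r_def)
    \<comment> \<open>The final constant 7 is 1 for rounding, 1 for the weight, 1 for the powers of
      1 + 1/r and 4 for 16^k.\<close>
    also have "exp (real (k\<^sup>2)) * (exp (real k * real (k - 1)) * (1 + 1 / r) ^ (k - 1)\<^sup>2 * (16 * x) ^ k)
      \<le> exp (real (k\<^sup>2)) * (exp (real (k\<^sup>2)) * (exp (real (k\<^sup>2)) * (ln x / real k) ^ (k - 1)\<^sup>2) * (exp (4 * real (k\<^sup>2)) * x ^ k))"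
    proof (intro mult_left_mono mult_mono)
      show "exp (real k * real (k - 1)) \<le> exp (real (k\<^sup>2))"
        by (simp add: power2_eq_square mult_left_mono)
      have "1 + 1 / r \<le> exp 1 * (ln x / real k)"
      proof -
        have "1 + 1 / r \<le> 2 * (ln x / real k)" using Lk Lpos k by (simp add: r_def field_simps)
        also have "\<dots> \<le> exp 1 * (ln x / real k)" using e2 Lpos by (intro mult_right_mono) auto
        finally show ?thesis .
      qed
      then have "(1 + 1 / r) ^ (k - 1)\<^sup>2 \<le> (exp 1 * (ln x / real k)) ^ (k - 1)\<^sup>2"
        using l by (intro power_mono) auto
      also have "\<dots> = exp (real ((k - 1)\<^sup>2)) * (ln x / real k) ^ (k - 1)\<^sup>2"
        by (subst power_mult_distrib, subst exp_of_nat_mult[symmetric]) (simp only: mult_1_right)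
      also have "\<dots> \<le> exp (real (k\<^sup>2)) * (ln x / real k) ^ (k - 1)\<^sup>2"
      proof (intro mult_right_mono)
        have "(k - 1)\<^sup>2 \<le> k\<^sup>2" by (rule power_mono) auto
        then show "exp (real ((k - 1)\<^sup>2)) \<le> exp (real (k\<^sup>2))" by (simp only: exp_le_cancel_iff of_nat_le_iff)
      qed (use Lpos in auto)
      finally show "(1 + 1 / r) ^ (k - 1)\<^sup>2 \<le> exp (real (k\<^sup>2)) * (ln x / real k) ^ (k - 1)\<^sup>2" .
      show "(16 * x) ^ k \<le> exp (4 * real (k\<^sup>2)) * x ^ k"
        unfolding power_mult_distrib using c16 x1 by (intro mult_right_mono) auto
    qed (use x1 l Lpos in auto)
    also have "\<dots> = x ^ k * (ln x / real k) ^ (k - 1)\<^sup>2 * (exp (real (k\<^sup>2)) * exp (real (k\<^sup>2)) * exp (real (k\<^sup>2)) * exp (4 * real (k\<^sup>2)))"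
      by (simp only: mult_ac)
    also have "exp (real (k\<^sup>2)) * exp (real (k\<^sup>2)) * exp (real (k\<^sup>2)) * exp (4 * real (k\<^sup>2)) = exp (7 * real (k\<^sup>2))"
      by (simp flip: exp_add)
    finally show ?thesis .
  qed
qed

section \<open>Counting tuples with prescribed product\<close>

text \<open>Double counting of the pairs of a subset and one of its elements. The sums are the
  elementary symmetric polynomials in the weights.\<close>

lemma sum_prod_subsets_Suc:
  fixes w :: "'b \<Rightarrow> real"
  assumes "finite P"
  shows "real (Suc n) * (\<Sum>A | A \<subseteq> P \<and> card A = Suc n. \<Prod>p\<in>A. w p)
    = (\<Sum>p\<in>P. w p * (\<Sum>B | B \<subseteq> P - {p} \<and> card B = n. \<Prod>p\<in>B. w p))"
proof -
  let ?A = "{A. A \<subseteq> P \<and> card A = Suc n}"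
  let ?B = "\<lambda>p. {B. B \<subseteq> P - {p} \<and> card B = n}"
  have fin: "finite A" if "A \<subseteq> P" for A using that assms finite_subset by blast
  have "real (Suc n) * (\<Sum>A\<in>?A. \<Prod>p\<in>A. w p) = (\<Sum>A\<in>?A. \<Sum>p\<in>A. prod w A)"
    unfolding sum_distrib_left by (intro sum.cong refl) simp
  also have "\<dots> = (\<Sum>(A, p)\<in>Sigma ?A (\<lambda>A. A). prod w A)"
    using assms fin by (intro sum.Sigma) (auto intro: finite_subset[of _ "Pow P"])
  also have "\<dots> = (\<Sum>(p, B)\<in>Sigma P ?B. w p * prod w B)"
  proof (rule sum.reindex_bij_witness[of _ "\<lambda>(p, B). (insert p B, p)" "\<lambda>(A, p). (p, A - {p})"])
    fix z assume "z \<in> Sigma ?A (\<lambda>A. A)"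
    then obtain A p where z: "z = (A, p)" "A \<subseteq> P" "card A = Suc n" "p \<in> A" by auto
    then have "finite A" using fin by blast
    show "(case case z of (A, p) \<Rightarrow> (p, A - {p}) of (p, B) \<Rightarrow> (insert p B, p)) = z" using z by auto
    show "(case z of (A, p) \<Rightarrow> (p, A - {p})) \<in> Sigma P ?B" using z \<open>finite A\<close> by auto
    show "(case case z of (A, p) \<Rightarrow> (p, A - {p}) of (p, B) \<Rightarrow> w p * prod w B) = (case z of (A, p) \<Rightarrow> prod w A)"
      using z \<open>finite A\<close> by (simp add: prod.remove)
  next
    fix z assume "z \<in> Sigma P ?B"
    then obtain p B where z: "z = (p, B)" "p \<in> P" "B \<subseteq> P - {p}" "card B = n" by auto
    then have "finite B" "p \<notin> B" using fin[of B] by blast+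
    then show "(case case z of (p, B) \<Rightarrow> (insert p B, p) of (A, p) \<Rightarrow> (p, A - {p})) = z"
      "(case z of (p, B) \<Rightarrow> (insert p B, p)) \<in> Sigma ?A (\<lambda>A. A)"
      using z by auto
  qed
  also have "\<dots> = (\<Sum>p\<in>P. \<Sum>B\<in>?B p. w p * prod w B)"
    using assms by (intro sum.Sigma[symmetric]) (auto intro: finite_subset[of _ "Pow P"])
  finally show ?thesis by (simp add: sum_distrib_left)
qed

text \<open>Without repetitions to exclude, the elementary symmetric polynomial would be the n-th
  power of the total weight over n!. Each of the n steps removes one element of weight at most
  \<delta>, so the reserve n \<delta> keeps the remaining total at least t throughout.\<close>

lemma sum_prod_subsets_ge:
  fixes w :: "'b \<Rightarrow> real"
  assumes "finite P" "\<And>p. p \<in> P \<Longrightarrow> 0 \<le> w p \<and> w p \<le> \<delta>" "t \<ge> 0" "\<delta> \<ge> 0" "t + real n * \<delta> \<le> (\<Sum>p\<in>P. w p)"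
  shows "t ^ n / fact n \<le> (\<Sum>A | A \<subseteq> P \<and> card A = n. \<Prod>p\<in>A. w p)"
  using assms(1,2,5)
proof (induction n arbitrary: P)
  case 0
  have "{A. A \<subseteq> P \<and> card A = 0} = {{}}" using 0 finite_subset by fastforce
  then show ?case by simp
next
  case (Suc n)
  let ?e = "\<lambda>P n. \<Sum>A | A \<subseteq> P \<and> card A = n. \<Prod>p\<in>A. w p"
  have IH: "t ^ n / fact n \<le> ?e (P - {p}) n" if p: "p \<in> P" for p
  proof (rule Suc.IH)
    have "(\<Sum>q\<in>P. w q) = w p + (\<Sum>q\<in>P - {p}. w q)" using p Suc.prems(1) by (rule sum.remove[rotated])
    then show "t + real n * \<delta> \<le> (\<Sum>q\<in>P - {p}. w q)"
      using Suc.prems(2)[OF p] Suc.prems(3) by (simp add: algebra_simps)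
  qed (use Suc.prems in auto)
  have "0 \<le> real (Suc n) * \<delta>" using assms(4) by simp
  then have le: "t \<le> (\<Sum>p\<in>P. w p)" using Suc.prems(3) by linarith
  have "t * (t ^ n / fact n) \<le> (\<Sum>p\<in>P. w p) * (t ^ n / fact n)"
    using le assms(3) by (intro mult_right_mono) auto
  also have "\<dots> \<le> (\<Sum>p\<in>P. w p * ?e (P - {p}) n)"
    unfolding sum_distrib_right using IH Suc.prems(2) by (intro sum_mono mult_left_mono) auto
  also have "\<dots> = real (Suc n) * ?e P (Suc n)" using sum_prod_subsets_Suc[OF Suc.prems(1)] by simp
  finally have "t * (t ^ n / fact n) / real (Suc n) \<le> ?e P (Suc n)"
    by (subst pos_divide_le_eq) (auto simp: mult.commute simp del: of_nat_Suc)
  then show ?case by (simp add: mult.commute[of "fact n"])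
qed

lemma prod_primes_inj:
  assumes "finite A" "finite B" "\<And>p. p \<in> A \<union> B \<Longrightarrow> prime (p::nat)" "\<Prod>A = \<Prod>B"
  shows "A = B"
proof -
  have "p \<in> B" if h: "finite A" "finite B" "\<And>p. p \<in> A \<union> B \<Longrightarrow> prime (p::nat)" "\<Prod>A = \<Prod>B" "p \<in> A"
    for A B p
  proof -
    have "p dvd \<Prod>B" using h dvd_prodI[of A p "\<lambda>x. x"] by simp
    moreover have "prime p" using h by auto
    ultimately obtain r where "r \<in> B" "p dvd r" using h prime_dvd_prod_iff[of B p "\<lambda>x. x"] by auto
    then have "p = r" using h by (intro primes_dvd_imp_eq) auto
    then show ?thesis using \<open>r \<in> B\<close> by simp
  qed
  note sub = this
  have "p \<in> B" if "p \<in> A" for p using sub[OF assms that] .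
  moreover have "p \<in> A" if "p \<in> B" for p
    by (rule sub[OF assms(2,1) _ assms(4)[symmetric] that]) (use assms(3) in blast)
  ultimately show ?thesis by blast
qed

text \<open>Blocks of exactly J primes give a multinomial number of factorizations and bound every
  entry by y^J. The recursion chooses the block of the first entry, which that entry determines by
  unique factorization. The count is written without division because it lives in the natural
  numbers.\<close>

lemma balanced_factorizations:
  assumes "finite A" "\<And>p. p \<in> A \<Longrightarrow> prime (p::nat) \<and> real p \<le> y" "card A = k * J"
  shows "\<exists>D. finite D \<and> card D * fact J ^ k = fact (k * J) \<and>
    (\<forall>b\<in>D. length b = k \<and> prod_list b = \<Prod>A \<and> (\<forall>m\<in>set b. 0 < m \<and> real m \<le> y ^ J))"
  using assms
proof (induction k arbitrary: A)
  case 0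
  then show ?case by (intro exI[of _ "{[]}"]) auto
next
  case (Suc k)
  let ?\<B> = "{B. B \<subseteq> A \<and> card B = J}"
  define Q where "Q = (\<lambda>A D. finite D \<and> card D * fact J ^ k = fact (k * J) \<and>
    (\<forall>b\<in>D. length b = k \<and> prod_list b = \<Prod>A \<and> (\<forall>m\<in>set b. 0 < m \<and> real m \<le> y ^ J)))"
  have fin: "finite B" if "B \<in> ?\<B>" for B using that Suc.prems(1) finite_subset by blast
  have fin\<B>: "finite ?\<B>" by (rule finite_subset[of _ "Pow A"]) (use Suc.prems(1) in auto)
  have "\<exists>D. Q (A - B) D" if B: "B \<in> ?\<B>" for B
    unfolding Q_def
  proof (rule Suc.IH)
    show "finite (A - B)" "\<And>p. p \<in> A - B \<Longrightarrow> prime p \<and> real p \<le> y" using Suc.prems by auto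
    show "card (A - B) = k * J" using B fin[OF B] Suc.prems(3) by (simp add: card_Diff_subset)
  qed
  then obtain F where "\<And>B. B \<in> ?\<B> \<Longrightarrow> Q (A - B) (F B)" by metis
  note F = this[unfolded Q_def]
  define D where "D = (\<Union>B\<in>?\<B>. (\<lambda>b. \<Prod>B # b) ` F B)"
  have inj: "B = B'" if "B \<in> ?\<B>" "B' \<in> ?\<B>" "\<Prod>B = \<Prod>B'" for B B'
  proof (rule prod_primes_inj)
    show "finite B" "finite B'" using fin that(1,2) by blast+
    show "prime p" if p: "p \<in> B \<union> B'" for p
      using p \<open>B \<in> ?\<B>\<close> \<open>B' \<in> ?\<B>\<close> Suc.prems(2)[of p] by blast
    show "\<Prod>B = \<Prod>B'" by (fact that(3))
  qed
  have disj: "(\<lambda>b. \<Prod>B # b) ` F B \<inter> (\<lambda>b. \<Prod>B' # b) ` F B' = {}"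
    if "B \<in> ?\<B>" "B' \<in> ?\<B>" "B \<noteq> B'" for B B'
  proof -
    have "\<Prod>B \<noteq> \<Prod>B'" using inj[OF that(1,2)] that(3) by metis
    then show ?thesis by auto
  qed
  have finF: "finite (F B)" if "B \<in> ?\<B>" for B using F[OF that] by blast
  have "card D = (\<Sum>B\<in>?\<B>. card ((\<lambda>b. \<Prod>B # b) ` F B))"
    unfolding D_def using fin\<B>
  proof (rule card_UN_disjoint)
    show "\<forall>B\<in>?\<B>. finite ((\<lambda>b. \<Prod>B # b) ` F B)" by (intro ballI finite_imageI finF)
    show "\<forall>B\<in>?\<B>. \<forall>B'\<in>?\<B>. B \<noteq> B' \<longrightarrow> (\<lambda>b. \<Prod>B # b) ` F B \<inter> (\<lambda>b. \<Prod>B' # b) ` F B' = {}"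
      by (intro ballI impI disj)
  qed
  also have "\<dots> = (\<Sum>B\<in>?\<B>. card (F B))" by (intro sum.cong refl card_image) (auto simp: inj_on_def)
  finally have "card D * fact J ^ k = (\<Sum>B\<in>?\<B>. card (F B) * fact J ^ k)" by (simp add: sum_distrib_right)
  also have "\<dots> = (\<Sum>B\<in>?\<B>. fact (k * J))" using F by (intro sum.cong refl) blast
  also have "\<dots> = (Suc k * J choose J) * fact (k * J)" using n_subsets[OF Suc.prems(1), of J] Suc.prems(3) by simp
  finally have "card D * fact J ^ Suc k = fact J * fact (k * J) * (Suc k * J choose J)" by (simp add: mult_ac)
  also have "\<dots> = fact (Suc k * J)" using binomial_fact_lemma[of J "Suc k * J"] by simp
  finally have "card D * fact J ^ Suc k = fact (Suc k * J)" .
  moreover have "finite D" unfolding D_def by (intro finite_UN_I fin\<B> finite_imageI finF)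
  moreover have "length b = Suc k \<and> prod_list b = \<Prod>A \<and> (\<forall>m\<in>set b. 0 < m \<and> real m \<le> y ^ J)" if "b \<in> D" for b
  proof -
    from that obtain B b' where b: "B \<in> ?\<B>" "b = \<Prod>B # b'" "b' \<in> F B" by (auto simp: D_def)
    have "real (\<Prod>B) \<le> (\<Prod>p\<in>B. y)" unfolding of_nat_prod using b Suc.prems(2) by (intro prod_mono) auto
    moreover have "0 < \<Prod>B" using b Suc.prems(2) by (intro prod_pos) (auto simp: prime_gt_0_nat)
    moreover have "\<Prod>B * \<Prod>(A - B) = \<Prod>A"
      using b prod.subset_diff[OF _ Suc.prems(1), of B "\<lambda>x. x"] by (simp add: mult.commute)
    ultimately show ?thesis using b F[OF b(1)] by auto
  qed
  ultimately show ?case by blast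
qed

text \<open>Greedy choice from the end of the list: fewer than m values are taken whenever the next
  entry is chosen.\<close>

lemma card_distinct_lists_ge:
  assumes "\<And>S. S \<in> set Ss \<Longrightarrow> finite S \<and> m \<le> card S" "length Ss \<le> m"
  shows "finite {ps. list_all2 (\<in>) ps Ss \<and> distinct ps} \<and>
    (\<Prod>S\<leftarrow>Ss. card S - m) \<le> card {ps. list_all2 (\<in>) ps Ss \<and> distinct ps}"
  using assms
proof (induction Ss)
  case (Cons S Ss)
  let ?T = "{ps. list_all2 (\<in>) ps Ss \<and> distinct ps}"
  have IH: "finite ?T" "(\<Prod>S\<leftarrow>Ss. card S - m) \<le> card ?T" using Cons by auto
  have eq: "{ps. list_all2 (\<in>) ps (S # Ss) \<and> distinct ps} = (\<lambda>(ps, p). p # ps) ` Sigma ?T (\<lambda>ps. S - set ps)"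
    by (auto simp: list_all2_Cons2 image_iff)
  have finS: "finite S" using Cons.prems by simp
  have "(card S - m) * (\<Prod>S\<leftarrow>Ss. card S - m) \<le> (card S - m) * card ?T" using IH by (intro mult_left_mono) auto
  also have "\<dots> = (\<Sum>ps\<in>?T. card S - m)" by simp
  also have "\<dots> \<le> (\<Sum>ps\<in>?T. card (S - set ps))"
  proof (rule sum_mono)
    fix ps assume "ps \<in> ?T"
    then have "length ps = length Ss" by (auto dest: list_all2_lengthD)
    then have "card (set ps) \<le> m" using Cons.prems(2) card_length[of ps] by simp
    then show "card S - m \<le> card (S - set ps)" using diff_card_le_card_Diff[of "set ps" S] by simp
  qed
  also have "\<dots> = card (Sigma ?T (\<lambda>ps. S - set ps))" using IH finS by (subst card_SigmaI) auto
  also have "\<dots> = card {ps. list_all2 (\<in>) ps (S # Ss) \<and> distinct ps}"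
    unfolding eq by (rule card_image[symmetric]) (auto simp: inj_on_def)
  finally show ?case unfolding eq using IH finS by auto
next
  case Nil
  have "{ps::'a list. ps = [] \<and> distinct ps} = {[]}" by auto
  then show ?case by simp
qed

text \<open>Cauchy-Schwarz over the fibres of \<open>g\<close>, of which there are at most
  Q.\<close>

lemma card_sq_le_fibres:
  assumes "finite D" "card (g ` D) \<le> Q"
  shows "real (card D) ^ 2 \<le> real Q * real (card {(b, c) \<in> D \<times> D. g b = g c})"
proof -
  let ?f = "\<lambda>\<beta>. {b \<in> D. g b = \<beta>}"
  have "card D = (\<Sum>\<beta>\<in>g ` D. card (?f \<beta>))"
    using sum.image_gen[OF assms(1), of "\<lambda>_. 1::nat" g] by simp
  then have "real (card D) ^ 2 = (\<Sum>\<beta>\<in>g ` D. real (card (?f \<beta>))) ^ 2" by simp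
  also have "\<dots> \<le> (\<Sum>\<beta>\<in>g ` D. real (card (?f \<beta>)) ^ 2) * real (card (g ` D))"
    by (rule sum_squared_le_sum_of_squares)
  also have "(\<Sum>\<beta>\<in>g ` D. real (card (?f \<beta>)) ^ 2) = real (\<Sum>\<beta>\<in>g ` D. card (?f \<beta> \<times> ?f \<beta>))"
    by (simp add: card_cartesian_product power2_eq_square)
  also have "(\<Sum>\<beta>\<in>g ` D. card (?f \<beta> \<times> ?f \<beta>)) = card (\<Union>\<beta>\<in>g ` D. ?f \<beta> \<times> ?f \<beta>)"
    using assms by (intro card_UN_disjoint[symmetric]) auto
  also have "(\<Union>\<beta>\<in>g ` D. ?f \<beta> \<times> ?f \<beta>) = {(b, c) \<in> D \<times> D. g b = g c}" by auto
  also have "real (card {(b, c) \<in> D \<times> D. g b = g c}) * real (card (g ` D))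
      \<le> real (card {(b, c) \<in> D \<times> D. g b = g c}) * real Q"
    using assms by (intro mult_left_mono) auto
  finally show ?thesis by (simp add: mult.commute)
qed

section \<open>Tuples whose entries have comparable size\<close>

definition log_floor :: "nat \<Rightarrow> nat" where
  "log_floor n = nat \<lfloor>ln (real n)\<rfloor>"

lemma max_le_exp_mult:
  assumes "0 < m" "0 < n" "log_floor m = log_floor n"
  shows "real (max m n) \<le> exp 1 * real m"
proof -
  have "real n \<le> exp 1 * real m" if "0 < m" "0 < n" "log_floor m = log_floor n" for m n
  proof -
    have "ln (real m) \<ge> 0" "ln (real n) \<ge> 0" using that by auto
    then have "ln (real n) \<le> 1 + ln (real m)" using that(3) unfolding log_floor_def by linarith
    then have "ln (real n) \<le> ln (exp 1 * real m)" using that by (simp add: ln_mult)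
    then show ?thesis using that by (subst (asm) ln_le_cancel_iff) auto
  qed
  moreover have "real m \<le> exp 1 * real m" using assms exp_ge_add_one_self[of "1::real"] by simp
  ultimately show ?thesis using assms by (simp add: max_def)
qed

lemma prod_max_tail_le:
  assumes "length bs = length cs" "\<forall>m\<in>set bs. 0 < m" "\<forall>m\<in>set cs. 0 < m"
    "map log_floor bs = map log_floor cs"
  shows "real (prod_list (map2 max bs cs)) \<le> exp (real (length bs)) * real (prod_list bs)"
  using assms
proof (induction bs cs rule: list_induct2)
  case (Cons b bs c cs)
  have "real (max b c * prod_list (map2 max bs cs))
      \<le> (exp 1 * real b) * (exp (real (length bs)) * real (prod_list bs))"
    unfolding of_nat_mult using Cons by (intro mult_mono max_le_exp_mult) auto
  then show ?case by (simp add: exp_add mult_ac add.commute)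
qed simp

lemma map2_max_commute: "map2 max bs cs = map2 max cs (bs :: nat list)"
  by (intro nth_equalityI) (auto simp: max.commute)

text \<open>The heads need no comparison. If the head of \<open>bs\<close> is the larger one, the
  tail is compared with the tail of \<open>bs\<close>, otherwise with that of \<open>cs\<close>; in
  both cases the full product is the common one. This saves one class condition and thereby one
  factor log x.\<close>

lemma prod_max_le:
  assumes len: "length bs = k" "length cs = k" and pos: "\<forall>m\<in>set bs. 0 < m" "\<forall>m\<in>set cs. 0 < m"
    and eq: "prod_list bs = prod_list cs" and cls: "map log_floor (tl bs) = map log_floor (tl cs)"
  shows "real (prod_list (map2 max bs cs)) \<le> exp (real k) * real (prod_list bs)"
proof (cases bs)
  case Nil
  then show ?thesis using len by simp
next
  case (Cons b bs')
  then obtain c cs' where c: "cs = c # cs'" using len by (cases cs) auto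
  have l: "length bs' = length cs'" "length bs' \<le> k" using len Cons c by auto
  have t1: "real (prod_list (map2 max bs' cs')) \<le> exp (real (length bs')) * real (prod_list bs')"
    using pos cls Cons c l by (intro prod_max_tail_le) auto
  have t2: "real (prod_list (map2 max bs' cs')) \<le> exp (real (length bs')) * real (prod_list cs')"
    using pos cls Cons c l prod_max_tail_le[of cs' bs'] by (simp add: map2_max_commute[of bs'])
  have "real (max b c * prod_list (map2 max bs' cs')) \<le> exp (real (length bs')) * real (prod_list bs)"
  proof (cases "c \<le> b")
    case True
    then show ?thesis using mult_left_mono[OF t1, of "real b"] Cons by (simp add: mult_ac max_def)
  next
    case False
    then show ?thesis using mult_left_mono[OF t2, of "real c"] c unfolding eq by (simp add: mult_ac max_def)
  qed
  also have "\<dots> \<le> exp (real k) * real (prod_list bs)" using l by (intro mult_right_mono) auto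
  finally show ?thesis using Cons c by simp
qed

section \<open>Extension by large primes\<close>

text \<open>The primes by which an entry m may be multiplied. The bound \<open>y\<close> will exceed
  all primes already present, so that the new prime can be recognised afterwards.\<close>

definition big_primes :: "nat \<Rightarrow> real \<Rightarrow> real \<Rightarrow> nat \<Rightarrow> nat set" where
  "big_primes q x y m = {p. prime p \<and> y < real p \<and> \<not> p dvd q \<and> real (p * m) \<le> x}"

lemma big_primes_le: "p \<in> big_primes q x y m \<Longrightarrow> 0 < m \<Longrightarrow> real p \<le> x"
proof -
  assume "p \<in> big_primes q x y m" "0 < m"
  then have "real (p * m) \<le> x" "p * 1 \<le> p * m" by (auto simp: big_primes_def)
  then show ?thesis by (metis le_trans mult.right_neutral of_nat_le_iff order_trans)
qed

lemma finite_big_primes: "0 < m \<Longrightarrow> finite (big_primes q x y m)"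
  by (rule finite_subset[of _ "{..nat \<lfloor>x\<rfloor>}"]) (auto dest!: big_primes_le simp: le_nat_floor)

lemma prod_list_map2_mult:
  "length bs = length ps \<Longrightarrow> prod_list (map2 (*) bs ps) = prod_list bs * prod_list (ps :: nat list)"
  by (induction bs ps rule: list_induct2) auto

lemma prod_list_le_power: "\<forall>m\<in>set ms. real m \<le> x \<Longrightarrow> real (prod_list ms) \<le> x ^ length ms"
proof (induction ms)
  case (Cons m ms)
  then have "0 \<le> x" by (metis list.set_intros(1) of_nat_0_le_iff order_trans)
  have "real m * real (prod_list ms) \<le> x * x ^ length ms"
    using Cons \<open>0 \<le> x\<close> by (intro mult_mono) auto
  then show ?case by simp
qed simp

lemma big_prime_not_dvd:
  assumes "finite A" "\<forall>p\<in>A. prime p \<and> real p \<le> y" "m dvd \<Prod>A" "prime p" "y < real p"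
  shows "\<not> p dvd m"
proof
  assume "p dvd m"
  then have "p dvd \<Prod>A" using assms(3) dvd_trans by blast
  then obtain r where "r \<in> A" "p dvd r" using prime_dvd_prod_iff[OF assms(1,4), of "\<lambda>x. x"] by blast
  then have "p = r" using assms(2,4) by (intro primes_dvd_imp_eq) auto
  then show False using assms(2,5) \<open>r \<in> A\<close> by fastforce
qed

lemma nth_dvd_prod_list: "i < length bs \<Longrightarrow> bs ! i dvd prod_list (bs :: nat list)"
  by (meson nth_mem prod_list_dvd)

text \<open>The same primes are attached to both tuples, so the i-th one has to fit the larger of
  the two entries. Distinctness makes the new common product squarefree.\<close>

definition prime_extensions :: "nat \<Rightarrow> real \<Rightarrow> real \<Rightarrow> nat list \<Rightarrow> nat list \<Rightarrow> nat list set" where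
  "prime_extensions q x y b c =
    {ps. list_all2 (\<in>) ps (map (big_primes q x y) (map2 max b c)) \<and> distinct ps}"

lemma prime_extensionsD:
  assumes "ps \<in> prime_extensions q x y b c" "length b = k" "length c = k"
  shows "length ps = k" "distinct ps"
    "\<And>i. i < k \<Longrightarrow> ps ! i \<in> big_primes q x y (max (b ! i) (c ! i))"
  using assms by (auto simp: prime_extensions_def list_all2_conv_all_nth)

lemma finite_prime_extensions:
  assumes "length b = k" "length c = k" "\<forall>m\<in>set b. 0 < m"
  shows "finite (prime_extensions q x y b c)"
proof (rule finite_subset)
  show "prime_extensions q x y b c \<subseteq> {ps. set ps \<subseteq> {..nat \<lfloor>x\<rfloor>} \<and> length ps = k}"
  proof
    fix ps assume ps: "ps \<in> prime_extensions q x y b c"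
    note D = prime_extensionsD[OF ps assms(1,2)]
    have "ps ! i \<le> nat \<lfloor>x\<rfloor>" if "i < k" for i
    proof -
      have "0 < max (b ! i) (c ! i)" using that assms by (auto simp: less_max_iff_disj)
      then show ?thesis using big_primes_le[OF D(3)[OF that]] by (simp add: le_nat_floor)
    qed
    then show "ps \<in> {ps. set ps \<subseteq> {..nat \<lfloor>x\<rfloor>} \<and> length ps = k}" using D(1) by (auto simp: in_set_conv_nth)
  qed
qed (rule finite_lists_length_eq, simp)

text \<open>Multiplying both tuples entrywise by \<open>ps\<close> keeps their products equal,
  squarefree and coprime to q. The result determines \<open>b\<close>, \<open>c\<close> and
  \<open>ps\<close>, because each entry has exactly one prime factor above y.\<close>

lemma sum_prime_extensions_le:
  assumes R: "finite R" and q: "q \<ge> 1"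
    and RD: "\<And>b c. (b, c) \<in> R \<Longrightarrow> length b = k \<and> length c = k \<and>
      (\<exists>A. finite A \<and> (\<forall>p\<in>A. prime p \<and> real p \<le> y \<and> \<not> p dvd q) \<and> prod_list b = \<Prod>A \<and> prod_list c = \<Prod>A)"
  shows "(\<Sum>(b, c)\<in>R. card (prime_extensions q x y b c))
    \<le> card {(ms, ns) \<in> product_pairs (pos_upto x) k. prod_list ms \<in> flat_upto q (x ^ k)}"
proof -
  let ?E = "\<lambda>(b, c). prime_extensions q x y b c"
  let ?T = "{(ms, ns) \<in> product_pairs (pos_upto x) k. prod_list ms \<in> flat_upto q (x ^ k)}"
  define \<Phi> where "\<Phi> = (\<lambda>((b, c), ps). (map2 (*) b ps, map2 (*) c ps :: nat list))"
  have pos: "\<forall>m\<in>set b. 0 < m" "\<forall>m\<in>set c. 0 < m" if zR: "(b, c) \<in> R" for b c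
  proof -
    obtain A where A: "\<forall>p\<in>A. prime p" "prod_list b = \<Prod>A" "prod_list c = \<Prod>A" using RD[OF zR] by blast
    then have "\<Prod>A > 0" by (intro prod_pos) (auto simp: prime_gt_0_nat)
    then have "0 \<notin> set b" "0 \<notin> set c" using A prod_list_zero_iff[of b] prod_list_zero_iff[of c] by auto
    then show "\<forall>m\<in>set b. 0 < m" "\<forall>m\<in>set c. 0 < m" by (metis neq0_conv)+
  qed
  have "(\<Sum>z\<in>R. card (?E z)) = card (Sigma R ?E)"
    using RD pos by (intro card_SigmaI[symmetric] R) (auto intro!: finite_prime_extensions)
  also have "\<dots> \<le> card ?T"
  proof (rule card_inj_on_le)
    show "finite ?T" by (rule finite_subset[OF _ finite_product_pairs[OF finite_pos_upto]]) auto
    show "\<Phi> ` Sigma R ?E \<subseteq> ?T"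
    proof
      fix z assume "z \<in> \<Phi> ` Sigma R ?E"
      then obtain b c ps where z: "(b, c) \<in> R" "ps \<in> prime_extensions q x y b c"
        "z = (map2 (*) b ps, map2 (*) c ps)" by (auto simp: \<Phi>_def)
      have len: "length b = k" "length c = k" using RD[OF z(1)] by auto
      obtain A where A: "finite A" "\<forall>p\<in>A. prime p \<and> real p \<le> y \<and> \<not> p dvd q"
        "prod_list b = \<Prod>A" "prod_list c = \<Prod>A" using RD[OF z(1)] by blast
      note D = prime_extensionsD[OF z(2) len]
      have ps: "prime p \<and> y < real p \<and> \<not> p dvd q" if "p \<in> set ps" for p
        using that D by (auto simp: in_set_conv_nth big_primes_def)
      have mem: "m \<in> pos_upto x" if "m \<in> set (map2 (*) d ps)" "d = b \<or> d = c" for m d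
      proof -
        from that D len obtain i where i: "i < k" "m = d ! i * ps ! i"
          by (auto simp: in_set_conv_nth)
        have "d ! i > 0" using i(1) pos[OF z(1)] len that(2) by auto
        moreover have "ps ! i > 0" using ps[of "ps ! i"] i D(1) by (simp add: prime_gt_0_nat)
        moreover have "d ! i * ps ! i \<le> ps ! i * max (b ! i) (c ! i)" using that(2) by auto
        then have "real m \<le> real (ps ! i * max (b ! i) (c ! i))" unfolding i(2) by (rule of_nat_mono)
        then have "real m \<le> x" using D(3)[OF i(1)] by (auto simp: big_primes_def)
        ultimately show ?thesis using i by (auto simp: pos_upto_def Suc_le_eq)
      qed
      have N: "prod_list (map2 (*) b ps) = \<Prod>A * prod_list ps" "prod_list (map2 (*) c ps) = \<Prod>A * prod_list ps"
        using A len D by (simp_all add: prod_list_map2_mult)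
      have disj: "A \<inter> set ps = {}" using A(2) ps by fastforce
      have "prod_list ps = \<Prod>(set ps)" using D(2) by (simp add: prod.distinct_set_conv_list[of ps "\<lambda>x. x", simplified])
      then have N': "\<Prod>A * prod_list ps = \<Prod>(A \<union> set ps)" using A(1) disj by (simp add: prod.union_disjoint)
      have P: "prime p \<and> \<not> p dvd q" if "p \<in> A \<union> set ps" for p using that A(2) ps by blast
      have "squarefree (\<Prod>(A \<union> set ps))"
        using P by (intro squarefree_prod_coprime primes_coprime squarefree_prime) auto
      moreover have "coprime (\<Prod>(A \<union> set ps)) q"
        using P by (intro prod_coprime_left prime_imp_coprime) auto
      moreover have "\<Prod>(A \<union> set ps) > 0" by (rule prod_pos) (use P prime_gt_0_nat in blast)
      moreover have "real (prod_list (map2 (*) b ps)) \<le> x ^ length (map2 (*) b ps)"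
        using mem by (intro prod_list_le_power) (auto simp: pos_upto_def)
      then have "real (\<Prod>(A \<union> set ps)) \<le> x ^ k" using N N' len D by simp
      ultimately have "prod_list (map2 (*) b ps) \<in> flat_upto q (x ^ k)"
        unfolding N N' by (simp add: flat_upto_def pos_upto_def Suc_le_eq)
      then show "z \<in> ?T" using z(3) mem len D(1) N by (auto simp: product_pairs_def)
    qed
    show "inj_on \<Phi> (Sigma R ?E)"
    proof (rule inj_onI)
      fix u v assume u: "u \<in> Sigma R ?E" and v: "v \<in> Sigma R ?E" and eq: "\<Phi> u = \<Phi> v"
      obtain b c ps where u': "u = ((b, c), ps)" by (cases u) auto
      obtain b' c' ps' where v': "v = ((b', c'), ps')" by (cases v) auto
      have uR: "(b, c) \<in> R" "ps \<in> prime_extensions q x y b c" using u u' by auto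
      have vR: "(b', c') \<in> R" "ps' \<in> prime_extensions q x y b' c'" using v v' by auto
      have len: "length b = k" "length c = k" "length b' = k" "length c' = k" using RD[OF uR(1)] RD[OF vR(1)] by auto
      note D = prime_extensionsD[OF uR(2) len(1,2)]
      note D' = prime_extensionsD[OF vR(2) len(3,4)]
      have eqs: "map2 (*) b ps = map2 (*) b' ps'" "map2 (*) c ps = map2 (*) c' ps'"
        using eq by (auto simp: \<Phi>_def u' v')
      \<comment> \<open>All primes of \<open>b' ! i\<close> are at most y, so the prime
        \<open>ps ! i\<close> > y must divide, hence equal, the prime \<open>ps' ! i\<close>;
        cancelling it gives the other two equations.\<close>
      have main: "ps ! i = ps' ! i \<and> b ! i = b' ! i \<and> c ! i = c' ! i" if i: "i < k" for i
      proof -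
        have e: "b ! i * ps ! i = b' ! i * ps' ! i" "c ! i * ps ! i = c' ! i * ps' ! i"
          using arg_cong[OF eqs(1), of "\<lambda>l. l ! i"] arg_cong[OF eqs(2), of "\<lambda>l. l ! i"] i len D D' by auto
        have p: "prime (ps ! i)" "y < real (ps ! i)" "prime (ps' ! i)"
          using D(3)[OF i] D'(3)[OF i] by (auto simp: big_primes_def)
        obtain A where A: "finite A" "\<forall>p\<in>A. prime p \<and> real p \<le> y" "prod_list b' = \<Prod>A" using RD[OF vR(1)] by blast
        have "\<not> ps ! i dvd b' ! i"
          using nth_dvd_prod_list[of i b'] i len A p by (intro big_prime_not_dvd[of A y]) auto
        moreover have "ps ! i dvd b' ! i * ps' ! i" using e(1) by (metis dvd_triv_right)
        ultimately have "ps ! i dvd ps' ! i" using p(1) prime_dvd_mult_iff by blast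
        then have "ps ! i = ps' ! i" using p by (intro primes_dvd_imp_eq) auto
        then show ?thesis using e p(1) prime_gt_0_nat by auto
      qed
      have "ps = ps'" "b = b'" "c = c'" using main len D(1) D'(1) by (auto intro!: nth_equalityI)
      then show "u = v" by (simp add: u' v')
    qed
  qed
  finally show ?thesis by (simp add: case_prod_unfold)
qed

text \<open>The summand k in the hypothesis pays for the primes excluded by distinctness; \<kappa>/m
  choices remain for each entry.\<close>

lemma card_prime_extensions_ge:
  assumes len: "length b = k" "length c = k" and \<kappa>: "\<kappa> > 0"
    and H: "\<And>m. m \<in> set (map2 max b c) \<Longrightarrow> 0 < m \<and> \<kappa> / real m + real k \<le> real (card (big_primes q x y m))"
  shows "\<kappa> ^ k / real (prod_list (map2 max b c)) \<le> real (card (prime_extensions q x y b c))"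
proof -
  let ?zs = "map2 max b c"
  let ?f = "big_primes q x y"
  have "\<kappa> ^ length zs / real (prod_list zs) \<le> real (\<Prod>S\<leftarrow>map ?f zs. card S - k)"
    if "\<And>m. m \<in> set zs \<Longrightarrow> 0 < m \<and> \<kappa> / real m + real k \<le> real (card (?f m))" for zs
    using that
  proof (induction zs)
    case (Cons z zs)
    have "\<kappa> / real z \<le> real (card (?f z) - k)" using Cons.prems[of z] by simp linarith
    then have "(\<kappa> / real z) * (\<kappa> ^ length zs / real (prod_list zs)) \<le> real (card (?f z) - k) * real (\<Prod>S\<leftarrow>map ?f zs. card S - k)"
      using Cons \<kappa> by (intro mult_mono) auto
    then show ?case by simp
  qed simp
  from this[of ?zs] have "\<kappa> ^ k / real (prod_list ?zs) \<le> real (\<Prod>S\<leftarrow>map ?f ?zs. card S - k)"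
    using H len by simp
  also have "\<dots> \<le> real (card (prime_extensions q x y b c))"
  proof (rule of_nat_mono)
    have "finite S \<and> k \<le> card S" if "S \<in> set (map ?f ?zs)" for S
    proof -
      from that obtain m where m: "m \<in> set ?zs" "S = ?f m" by auto
      have "0 \<le> \<kappa> / real m" using \<kappa> by simp
      then have "real k \<le> real (card (?f m))" using H[OF m(1)] by linarith
      then show ?thesis using m H[OF m(1)] finite_big_primes by simp
    qed
    moreover have "length (map ?f ?zs) \<le> k" using len by simp
    ultimately show "(\<Prod>S\<leftarrow>map ?f ?zs. card S - k) \<le> card (prime_extensions q x y b c)"
      unfolding prime_extensions_def using card_distinct_lists_ge[of "map ?f ?zs" k] by blast
  qed
  finally show ?thesis .
qed

text \<open>For each set A of kJ primes, Cauchy-Schwarz gives at least |D|^2 / B^(k-1) pairs of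
  balanced factorizations in a common class, and each pair has at least \<kappa>^k exp(-k) / M
  extensions, M being the product of A. Since M determines A, the contributions of different A are
  disjoint.\<close>

lemma card_flat_pairs_ge:
  assumes k: "k \<ge> 1" and q: "q \<ge> 1" and P: "finite P" "\<And>p. p \<in> P \<Longrightarrow> prime p \<and> real p \<le> y \<and> \<not> p dvd q"
    and \<kappa>: "\<kappa> > 0"
    and H: "\<And>m. 0 < m \<Longrightarrow> real m \<le> y ^ J \<Longrightarrow> \<kappa> / real m + real k \<le> real (card (big_primes q x y m))"
    and B: "\<And>m. 0 < m \<Longrightarrow> real m \<le> y ^ J \<Longrightarrow> log_floor m < B"
  shows "\<kappa> ^ k * exp (- real k) / real B ^ (k - 1) * (fact (k * J) / fact J ^ k)\<^sup>2 *
      (\<Sum>A | A \<subseteq> P \<and> card A = k * J. \<Prod>p\<in>A. 1 / real p)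
    \<le> real (card {(ms, ns) \<in> product_pairs (pos_upto x) k. prod_list ms \<in> flat_upto q (x ^ k)})"
proof -
  let ?\<A> = "{A. A \<subseteq> P \<and> card A = k * J}"
  define Q where "Q = (\<lambda>A D. finite D \<and> card D * fact J ^ k = fact (k * J) \<and>
    (\<forall>b\<in>D. length b = k \<and> prod_list b = \<Prod>A \<and> (\<forall>m\<in>set b. 0 < m \<and> real m \<le> y ^ J)))"
  have fin\<A>: "finite ?\<A>" by (rule finite_subset[of _ "Pow P"]) (use P(1) in auto)
  have finA: "finite A" if "A \<in> ?\<A>" for A using that P(1) finite_subset by blast
  have "\<exists>D. Q A D" if A: "A \<in> ?\<A>" for A
    unfolding Q_def
  proof (rule balanced_factorizations[OF finA[OF A]])
    show "prime p \<and> real p \<le> y" if "p \<in> A" for p using that A P(2)[of p] by blast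
  qed (use A in blast)
  then obtain D where "\<And>A. A \<in> ?\<A> \<Longrightarrow> Q A (D A)" by metis
  note D = this[unfolded Q_def]
  have D1: "finite (D A)" "card (D A) * fact J ^ k = fact (k * J)" if "A \<in> ?\<A>" for A using D[OF that] by blast+
  have D2: "length b = k" "prod_list b = \<Prod>A" "\<And>m. m \<in> set b \<Longrightarrow> 0 < m \<and> real m \<le> y ^ J"
    if "A \<in> ?\<A>" "b \<in> D A" for A b using D[OF that(1)] that(2) by blast+
  \<comment> \<open>Dropping the first entry from the class is what \<open>prod_max_le\<close>
    permits; it makes the exponent of B equal to k - 1.\<close>
  define g where "g = (\<lambda>b :: nat list. map log_floor (tl b))"
  define R where "R = (\<lambda>A. {(b, c) \<in> D A \<times> D A. g b = g c})"
  have finR: "finite (R A)" if "A \<in> ?\<A>" for A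
    unfolding R_def by (rule finite_subset[of _ "D A \<times> D A"]) (use D1(1)[OF that] in auto)
  have each: "\<kappa> ^ k * exp (- real k) / real B ^ (k - 1) * (fact (k * J) / fact J ^ k)\<^sup>2 * (\<Prod>p\<in>A. 1 / real p)
      \<le> real (\<Sum>(b, c)\<in>R A. card (prime_extensions q x y b c))" if A: "A \<in> ?\<A>" for A
  proof -
    have prodA: "\<Prod>A > 0" using A P(2) by (intro prod_pos) (auto simp: prime_gt_0_nat)
    have "card (g ` D A) \<le> card {xs. set xs \<subseteq> {..<B} \<and> length xs = k - 1}"
    proof (rule card_mono)
      show "g ` D A \<subseteq> {xs. set xs \<subseteq> {..<B} \<and> length xs = k - 1}"
      proof
        fix v assume "v \<in> g ` D A"
        then obtain b where b: "b \<in> D A" "v = g b" by blast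
        have "m \<in> set b" if "m \<in> set (tl b)" for m using that by (metis list.sel(2) list.set_sel(2))
        then show "v \<in> {xs. set xs \<subseteq> {..<B} \<and> length xs = k - 1}"
          using D2[OF A b(1)] B by (auto simp: b(2) g_def)
      qed
    qed (rule finite_lists_length_eq, simp)
    then have "card (g ` D A) \<le> B ^ (k - 1)" by (simp add: card_lists_length_eq)
    from card_sq_le_fibres[OF D1(1)[OF A] this]
    have cs: "real (card (D A)) ^ 2 \<le> real (B ^ (k - 1)) * real (card (R A))" by (simp add: R_def)
    have cD: "real (card (D A)) = fact (k * J) / fact J ^ k"
      using arg_cong[OF D1(2)[OF A], of real] by (simp add: field_simps)
    have "0 < B"
    proof -
      have "D A \<noteq> {}" using D1(2)[OF A] by (metis card.empty fact_nonzero mult_0)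
      then obtain b where b: "b \<in> D A" by blast
      then have "b \<noteq> []" using D2(1)[OF A b] k by auto
      then show ?thesis using B D2(3)[OF A b, of "hd b"] by (metis gr_zeroI hd_in_set not_less_zero)
    qed
    then have "(fact (k * J) / fact J ^ k)\<^sup>2 / real B ^ (k - 1) \<le> real (card (R A))"
      using cs unfolding cD by (simp add: field_simps)
    then have "(fact (k * J) / fact J ^ k)\<^sup>2 / real B ^ (k - 1) * (\<kappa> ^ k * exp (- real k) / real (\<Prod>A))
        \<le> real (card (R A)) * (\<kappa> ^ k * exp (- real k) / real (\<Prod>A))"
      using \<kappa> prodA by (intro mult_right_mono divide_nonneg_nonneg mult_nonneg_nonneg) (auto simp del: of_nat_prod)
    also have "\<dots> = (\<Sum>z\<in>R A. \<kappa> ^ k * exp (- real k) / real (\<Prod>A))" by simp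
    also have "\<dots> \<le> (\<Sum>(b, c)\<in>R A. real (card (prime_extensions q x y b c)))"
    proof (rule sum_mono)
      fix z assume "z \<in> R A"
      then obtain b c where z: "z = (b, c)" "b \<in> D A" "c \<in> D A" "g b = g c" by (auto simp: R_def)
      note b = D2[OF A z(2)] and c = D2[OF A z(3)]
      have mx: "real (prod_list (map2 max b c)) \<le> exp (real k) * real (\<Prod>A)"
        using prod_max_le[of b k c] b c z(4) by (simp add: g_def)
      have mem: "0 < m \<and> real m \<le> y ^ J" if "m \<in> set (map2 max b c)" for m
      proof -
        from that obtain i j where "m = max i j" "(i, j) \<in> set (zip b c)" by auto
        then show ?thesis using b(3) c(3) by (metis max_def set_zip_leftD set_zip_rightD)
      qed
      have "0 < prod_list (map2 max b c)"
        using mem prod_list_zero_iff[of "map2 max b c"] by (metis gr_zeroI less_irrefl)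
      then have "\<kappa> ^ k / (exp (real k) * real (\<Prod>A)) \<le> \<kappa> ^ k / real (prod_list (map2 max b c))"
        using mx \<kappa> prodA by (intro divide_left_mono mult_pos_pos) (auto simp del: of_nat_prod)
      also have "\<dots> \<le> real (card (prime_extensions q x y b c))"
        using b(1) c(1) \<kappa> mem H by (intro card_prime_extensions_ge) auto
      finally show "\<kappa> ^ k * exp (- real k) / real (\<Prod>A) \<le> (case z of (b, c) \<Rightarrow> real (card (prime_extensions q x y b c)))"
        by (simp add: z(1) exp_minus field_simps)
    qed
    finally show ?thesis by (simp add: prod_dividef case_prod_unfold mult_ac)
  qed
  have disj: "R A \<inter> R A' = {}" if "A \<in> ?\<A>" "A' \<in> ?\<A>" "A \<noteq> A'" for A A'
  proof -
    have "\<Prod>A \<noteq> \<Prod>A'"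
    proof
      assume "\<Prod>A = \<Prod>A'"
      then have "A = A'"
        using finA[OF that(1)] finA[OF that(2)] that P(2) by (intro prod_primes_inj) auto
      then show False using that by blast
    qed
    then have "D A \<inter> D A' = {}" using D2(2)[OF that(1)] D2(2)[OF that(2)] by (metis disjoint_iff)
    then show ?thesis by (auto simp: R_def)
  qed
  have "\<kappa> ^ k * exp (- real k) / real B ^ (k - 1) * (fact (k * J) / fact J ^ k)\<^sup>2 * (\<Sum>A\<in>?\<A>. \<Prod>p\<in>A. 1 / real p)
      \<le> (\<Sum>A\<in>?\<A>. real (\<Sum>(b, c)\<in>R A. card (prime_extensions q x y b c)))"
    unfolding sum_distrib_left by (rule sum_mono[OF each])
  also have "\<dots> = real (\<Sum>(b, c)\<in>(\<Union>A\<in>?\<A>. R A). card (prime_extensions q x y b c))"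
    using finR disj by (subst sum.UNION_disjoint[OF fin\<A>]) auto
  also have "\<dots> \<le> real (card {(ms, ns) \<in> product_pairs (pos_upto x) k. prod_list ms \<in> flat_upto q (x ^ k)})"
  proof (rule of_nat_mono, rule sum_prime_extensions_le[OF _ q])
    show "finite (\<Union>A\<in>?\<A>. R A)" using fin\<A> finR by blast
    fix b c assume "(b, c) \<in> (\<Union>A\<in>?\<A>. R A)"
    then obtain A where A: "A \<in> ?\<A>" "b \<in> D A" "c \<in> D A" by (auto simp: R_def)
    show "length b = k \<and> length c = k \<and>
      (\<exists>A. finite A \<and> (\<forall>p\<in>A. prime p \<and> real p \<le> y \<and> \<not> p dvd q) \<and> prod_list b = \<Prod>A \<and> prod_list c = \<Prod>A)"
      using D2(1,2)[OF A(1,2)] D2(1,2)[OF A(1,3)] finA[OF A(1)] A(1) P(2) by blast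
  qed
  finally show ?thesis .
qed

section \<open>The lower bound\<close>

text \<open>Stirling's upper bound in the form J! <= e J (J/e)^J. The induction step is ln(J/(J+1))
  <= -1/(J+1).\<close>

lemma ln_fact_upper:
  assumes "J \<ge> 1"
  shows "ln (fact J) \<le> 1 + ln (real J) + real J * ln (real J) - real J"
  using assms
proof (induction J rule: dec_induct)
  case (step J)
  have J: "real J > 0" using step by simp
  have "ln (real J / (real J + 1)) \<le> real J / (real J + 1) - 1" using J by (intro ln_le_minus_one) auto
  also have "\<dots> = - (1 / (real J + 1))" using J by (simp add: field_simps)
  finally have "ln (real J) - ln (real J + 1) \<le> - (1 / (real J + 1))" using J by (simp add: ln_div)
  then have "(real J + 1) * (ln (real J) - ln (real J + 1)) \<le> (real J + 1) * - (1 / (real J + 1))"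
    using J by (intro mult_left_mono) auto
  then have "(real J + 1) * (ln (real J) - ln (real J + 1)) \<le> - 1" using J by simp
  moreover have "ln (fact (Suc J) :: real) = ln (real J + 1) + ln (fact J)"
    by (simp add: ln_mult add.commute)
  ultimately show ?case using step.IH by (simp add: algebra_simps)
qed simp

text \<open>With n = k^2 t and J = kt the expression is n! t^n / J!^(2k). Stirling turns it into e^n
  (nt/J^2)^n up to the factor (eJ)^(2k), and nt = J^2 for this J. The factor (ekt)^(2k) is absorbed
  by the terms 4 and 2 ln t.\<close>

lemma balanced_weight_ge:
  assumes k: "k \<ge> 1" and t: "t \<ge> 1"
  shows "exp ((real k)\<^sup>2 * (real t - 4 - 2 * ln (real t)))
    \<le> (fact (k * (k * t)) / fact (k * t) ^ k)\<^sup>2 * (real t ^ (k * (k * t)) / fact (k * (k * t)))"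
proof -
  let ?J = "k * t" and ?n = "k * (k * t)"
  have pos: "real k > 0" "real t > 0" using assms by auto
  have lnJ: "ln (real ?J) = ln (real k) + ln (real t)" using pos by (simp add: ln_mult)
  have lnn: "ln (real ?n) = 2 * ln (real k) + ln (real t)" using pos by (simp add: ln_mult)
  have J1: "?J \<ge> 1" using assms by (simp add: Suc_le_eq)
  have f: "real ?n * ln (real ?n) - real ?n \<le> ln (fact ?n)" by (rule ln_fact_ge)
  have "2 * real k * ln (fact ?J) \<le> 2 * real k * (1 + ln (real ?J) + real ?J * ln (real ?J) - real ?J)"
    using ln_fact_upper[OF J1] pos by (intro mult_left_mono) auto
  also have "\<dots> = 2 * real k * (1 + ln (real k) + ln (real t)) + 2 * real ?n * (ln (real k) + ln (real t)) - 2 * real ?n"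
    unfolding lnJ by (simp add: algebra_simps)
  finally have g: "2 * real k * ln (fact ?J) \<le> \<dots>" .
  have lnk: "ln (real k) \<le> real k" using ln_le_minus_one[of "real k"] pos by linarith
  have k2: "real k \<le> (real k)\<^sup>2" using k by (simp add: power2_eq_square)
  define S where "S = real k * (1 + ln (real k) + ln (real t))"
  have S: "S \<le> 2 * (real k)\<^sup>2 + (real k)\<^sup>2 * ln (real t)"
  proof -
    have "real k * ln (real k) \<le> real k * real k" using lnk pos by (intro mult_left_mono) auto
    moreover have "real k * ln (real t) \<le> (real k)\<^sup>2 * ln (real t)" using k2 t by (intro mult_right_mono) auto
    ultimately show ?thesis using k2 by (simp add: S_def algebra_simps power2_eq_square)
  qed
  have f': "2 * (real ?n * ln (real k)) + real ?n * ln (real t) - real ?n \<le> ln (fact ?n)"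
    using f unfolding lnn by (simp only: algebra_simps)
  have g': "2 * real k * ln (fact ?J) \<le> 2 * S + 2 * (real ?n * ln (real k)) + 2 * (real ?n * ln (real t)) - 2 * real ?n"
    using g unfolding S_def by (simp only: algebra_simps)
  have "real ?n = (real k)\<^sup>2 * real t" by (simp add: power2_eq_square)
  then have "(real k)\<^sup>2 * (real t - 4 - 2 * ln (real t)) = real ?n - 4 * (real k)\<^sup>2 - 2 * ((real k)\<^sup>2 * ln (real t))"
    by (simp only: algebra_simps)
  then have "(real k)\<^sup>2 * (real t - 4 - 2 * ln (real t))
      \<le> ln (fact ?n) - 2 * real k * ln (fact ?J) + real ?n * ln (real t)"
    using S f' g' by linarith
  also have "\<dots> = ln ((fact ?n / fact ?J ^ k)\<^sup>2 * (real t ^ ?n / fact ?n))"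
    using pos by (simp add: ln_mult ln_div ln_realpow algebra_simps)
  finally show ?thesis using pos by (subst (asm) ln_ge_iff) auto
qed

section \<open>Losses from small primes and from the primes dividing q\<close>

lemma card_big_primes_ge:
  assumes q: "q \<ge> 1" and m: "0 < m" and y: "y \<ge> 0"
  shows "real (card {p. prime p \<and> real p \<le> x / real m}) - y - real (card (prime_factors q))
    \<le> real (card (big_primes q x y m))"
proof -
  let ?A = "{p. prime p \<and> real p \<le> x / real m}"
  have sub: "?A \<subseteq> big_primes q x y m \<union> ({0<..nat \<lfloor>y\<rfloor>} \<union> prime_factors q)"
  proof
    fix p assume p: "p \<in> ?A"
    then have pm: "real (p * m) \<le> x" using m by (simp add: field_simps)
    show "p \<in> big_primes q x y m \<union> ({0<..nat \<lfloor>y\<rfloor>} \<union> prime_factors q)"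
    proof (cases "y < real p \<and> \<not> p dvd q")
      case True then show ?thesis using p pm by (simp add: big_primes_def)
    next
      case False
      then show ?thesis using p q by (auto simp: prime_factors_dvd prime_gt_0_nat le_nat_floor)
    qed
  qed
  have "card ?A \<le> card (big_primes q x y m \<union> ({0<..nat \<lfloor>y\<rfloor>} \<union> prime_factors q))"
    by (rule card_mono[OF _ sub]) (use finite_big_primes[OF m] in auto)
  also have "\<dots> \<le> card (big_primes q x y m) + (card {0<..nat \<lfloor>y\<rfloor>} + card (prime_factors q))"
    by (intro order_trans[OF card_Un_le] add_left_mono card_Un_le)
  finally have "real (card ?A) \<le> real (card (big_primes q x y m)) + (real (nat \<lfloor>y\<rfloor>) + real (card (prime_factors q)))"
    by simp
  moreover have "real (nat \<lfloor>y\<rfloor>) \<le> y" using y by simp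
  ultimately show ?thesis by linarith
qed

lemma sum_inverse_primes_coprime_ge:
  assumes q: "q \<ge> 1" and z: "z > 0" and y: "y \<ge> 0"
  shows "(\<Sum>p | prime p \<and> z < real p \<and> real p \<le> y. 1 / real p) - real (card (prime_factors q)) / z
    \<le> (\<Sum>p | prime p \<and> z < real p \<and> real p \<le> y \<and> \<not> p dvd q. 1 / real p)"
proof -
  let ?A = "{p. prime p \<and> z < real p \<and> real p \<le> y}"
  have finA: "finite ?A" by (rule finite_subset[of _ "{..nat \<lfloor>y\<rfloor>}"]) (auto simp: le_nat_floor)
  have "(\<Sum>p\<in>?A. 1 / real p) = (\<Sum>p\<in>?A \<inter> {p. p dvd q}. 1 / real p) + (\<Sum>p\<in>?A - {p. p dvd q}. 1 / real p)"
    by (rule sum.Int_Diff[OF finA])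
  also have "?A - {p. p dvd q} = {p. prime p \<and> z < real p \<and> real p \<le> y \<and> \<not> p dvd q}" by auto
  also have "(\<Sum>p\<in>?A \<inter> {p. p dvd q}. 1 / real p) \<le> (\<Sum>p\<in>?A \<inter> {p. p dvd q}. 1 / z)"
    using z by (intro sum_mono divide_left_mono) auto
  also have "\<dots> \<le> real (card (prime_factors q)) / z"
  proof -
    have "card (?A \<inter> {p. p dvd q}) \<le> card (prime_factors q)"
      using q by (intro card_mono) (auto simp: prime_factors_dvd)
    then show ?thesis using z by (simp add: divide_right_mono)
  qed
  finally show ?thesis by simp
qed

lemma card_flat_pairs_ge_1:
  assumes "x \<ge> 1"
  shows "1 \<le> card {(ms, ns) \<in> product_pairs (pos_upto x) k. prod_list ms \<in> flat_upto q (x ^ k)}"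
proof -
  let ?T = "{(ms, ns) \<in> product_pairs (pos_upto x) k. prod_list ms \<in> flat_upto q (x ^ k)}"
  have "finite ?T" by (rule finite_subset[OF _ finite_product_pairs[OF finite_pos_upto]]) auto
  moreover have "(replicate k 1, replicate k 1) \<in> ?T"
  proof -
    have "set (replicate k 1) \<subseteq> pos_upto x" using assms by (auto simp: pos_upto_def)
    moreover have "prod_list (replicate k (1::nat)) = 1" by simp
    moreover have "1 \<in> flat_upto q (x ^ k)" using assms by (simp add: flat_upto_def pos_upto_def)
    ultimately show ?thesis by (simp add: product_pairs_def)
  qed
  ultimately have "card ?T > 0" by (auto simp only: card_gt_0_iff)
  then show ?thesis by simp
qed

text \<open>Here L stands for ln x and u for x/m with m <= x^(1/8), whence the exponent 7/8. The
  term 3 exp(L/2) will cover three losses: primes up to y, primes dividing q, and the k primes set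
  aside for distinctness.\<close>

lemma large_prime_count_bound:
  "\<exists>c>0. \<exists>L0\<ge>2. \<forall>L\<ge>L0. \<forall>u. exp (7 * L / 8) \<le> u \<longrightarrow> u \<le> exp L \<longrightarrow>
     c * u / L + 3 * exp (L / 2) \<le> real (card {p. prime p \<and> real p \<le> u})"
proof -
  obtain c u0 where c: "c > 0" "\<And>u. u \<ge> u0 \<Longrightarrow> c * u / ln u \<le> real (card {p. prime p \<and> real p \<le> u})"
    using prime_count_ge by blast
  \<comment> \<open>The estimate below needs 3L <= (c/2)(9/256) L^2, that is cL >= 1536/9, which is
    just below 171.\<close>
  define L1 where "L1 = max (2 * \<bar>u0\<bar>) (171 / c)"
  have L1: "u0 \<le> exp (7 * L / 8) \<and> 3 * exp (L / 2) * L \<le> c / 2 * exp (7 * L / 8)" if "L \<ge> L1" for L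
  proof
    have L: "L \<ge> 2 * \<bar>u0\<bar>" "L \<ge> 171 / c" using that by (auto simp: L1_def)
    then have Lpos: "L \<ge> 0" by linarith
    show "u0 \<le> exp (7 * L / 8)" using exp_ge_add_one_self[of "7 * L / 8"] L by linarith
    have "(3 * L / 16) ^ 2 \<le> exp (3 * L / 16) ^ 2"
      using exp_ge_add_one_self[of "3 * L / 16"] Lpos by (intro power_mono) linarith+
    also have "\<dots> = exp (3 * L / 8)" by (simp flip: exp_double)
    finally have e: "9 / 256 * (L * L) \<le> exp (3 * L / 8)" by (simp add: power2_eq_square)
    have "171 * L \<le> c * L * L" using mult_right_mono[OF L(2) Lpos] c(1) by (simp add: field_simps)
    then have "3 * L \<le> c / 2 * (9 / 256 * (L * L))" using Lpos by (simp add: field_simps)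
    also have "\<dots> \<le> c / 2 * exp (3 * L / 8)" using e c(1) by (intro mult_left_mono) auto
    finally have "exp (L / 2) * (3 * L) \<le> exp (L / 2) * (c / 2 * exp (3 * L / 8))" by (intro mult_left_mono) auto
    also have "\<dots> = c / 2 * (exp (L / 2) * exp (3 * L / 8))" by (simp only: mult_ac)
    also have "exp (L / 2) * exp (3 * L / 8) = exp (7 * L / 8)" by (simp flip: exp_add)
    finally show "3 * exp (L / 2) * L \<le> c / 2 * exp (7 * L / 8)" by (simp only: mult_ac)
  qed
  have "c / 2 * u / L + 3 * exp (L / 2) \<le> real (card {p. prime p \<and> real p \<le> u})"
    if L: "L \<ge> max L1 2" and u: "exp (7 * L / 8) \<le> u" "u \<le> exp L" for L u
  proof -
    have L2: "L \<ge> L1" "L \<ge> 2" using L by auto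
    have upos: "u > 1" using u(1) L2 by (metis exp_gt_one less_le_trans divide_pos_pos mult_pos_pos zero_less_numeral)
    have lnu: "0 < ln u" "ln u \<le> L" using upos u(2) by (auto simp: ln_le_cancel_iff[of u "exp L", simplified])
    have "c / 2 * exp (7 * L / 8) \<le> c / 2 * u" using u(1) c(1) by (intro mult_left_mono) auto
    then have "3 * exp (L / 2) * L \<le> c / 2 * u" using L1[OF L2(1)] by linarith
    then have "3 * exp (L / 2) \<le> c / 2 * u / L" using L2 by (simp add: field_simps)
    then have "c / 2 * u / L + 3 * exp (L / 2) \<le> c * u / L" by simp
    also have "\<dots> \<le> c * u / ln u" using lnu upos c(1) L2 by (intro divide_left_mono mult_pos_pos) auto
    also have "\<dots> \<le> real (card {p. prime p \<and> real p \<le> u})" using c(2) L1[OF L2(1)] u(1) by force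
    finally show ?thesis .
  qed
  then show ?thesis using c(1) by (intro exI[of _ "c / 2"] conjI exI[of _ "max L1 2"]) auto
qed

text \<open>The size condition on x amounts to W >= e. So w >= 1 and ln w >= 0, which lets powers of
  w absorb errors.\<close>

lemma flat_pairs_parameters:
  fixes k q K :: nat and x :: real
  assumes k: "k \<ge> 1" and K: "K = max k (card (prime_factors q))" "K \<ge> 2"
    and x: "x \<ge> real K powr (exp 1 * real k)"
  defines "L \<equiv> ln x" and "l \<equiv> ln (real K)" and "W \<equiv> ln x / (real k * ln (real K))"
    and "w \<equiv> ln (ln x / (real k * ln (real K)))"
  shows "x > 1" "L = real k * l * W" "L \<ge> exp 1 * (real k * l)" "l \<ge> 2/3" "W \<ge> exp 1" "w \<ge> 1" "w \<le> W"
    "L > 1" "real K \<le> exp (L / 2)" "W = exp w"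
proof -
  show l: "l \<ge> 2/3"
  proof -
    have "ln 2 \<le> ln (real K)" using K(2) by (subst ln_le_cancel_iff) auto
    then show ?thesis using ln2_ge_two_thirds by (simp add: l_def)
  qed
  have e2: "exp 1 \<ge> (2::real)" using exp_ge_add_one_self[of "1::real"] by simp
  have "real K powr (exp 1 * real k) > real K powr 0" using K(2) k by (subst powr_less_cancel_iff) auto
  then show x1: "x > 1" using x K(2) by simp
  have "ln (real K powr (exp 1 * real k)) \<le> ln x" using x x1 K(2) by (subst ln_le_cancel_iff) auto
  then show Le: "L \<ge> exp 1 * (real k * l)" using K(2) by (simp add: L_def l_def ln_powr mult_ac)
  have kl: "real k * l > 0" using k l by simp
  have kl1: "real k * l \<ge> l" using k l by simp
  have "real k \<noteq> 0" "ln (real K) \<noteq> 0" using k l by (auto simp: l_def)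
  then show "L = real k * l * W" by (simp add: L_def W_def l_def)
  show W: "W \<ge> exp 1" using Le kl by (simp add: W_def L_def l_def field_simps)
  then have Wp: "W > 0" using e2 by linarith
  have "ln W \<ge> ln (exp 1)" using W Wp by (subst ln_le_cancel_iff) auto
  then show "w \<ge> 1" by (simp add: w_def W_def)
  show "w \<le> W" using ln_le_minus_one[OF Wp] by (simp add: w_def W_def)
  show "W = exp w" using Wp by (simp add: w_def W_def)
  have L2: "L \<ge> 2 * (real k * l)" using Le mult_right_mono[OF e2, of "real k * l"] kl by linarith
  then show "L > 1" using kl1 l by linarith
  have "l \<le> L / 2" using L2 kl1 by linarith
  then have "exp l \<le> exp (L / 2)" by simp
  then show "real K \<le> exp (L / 2)" using K(2) by (simp add: l_def)
qed

text \<open>The lower bound before the 2k-th root, in exponential form. The coefficient 2k - 1 of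
  ln(ln x) is k from the density of primes plus k - 1 from the classes.\<close>

lemma card_flat_pairs_exp_ge:
  "\<exists>C>0. \<forall>(q::nat) (k::nat) (x::real) (K::nat). q \<ge> 1 \<longrightarrow> k \<ge> 1 \<longrightarrow> K = max k (card (prime_factors q)) \<longrightarrow>
     K \<ge> 2 \<longrightarrow> x \<ge> real K powr (exp 1 * real k) \<longrightarrow>
     exp (real k * ln x - (2 * real k - 1) * ln (ln x) + (real k)\<^sup>2 * ln (ln x / (real k * ln (real K)))
         - C * (real k)\<^sup>2 - C * (real k)\<^sup>2 * ln (ln (ln x / (real k * ln (real K)))))
       \<le> real (card {(ms, ns) \<in> product_pairs (pos_upto x) k. prod_list ms \<in> flat_upto q (x ^ k)})"
proof -
  obtain c L0 where c: "c > 0" and L0: "L0 \<ge> 2"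
    and count: "\<And>L u. L \<ge> L0 \<Longrightarrow> exp (7 * L / 8) \<le> u \<Longrightarrow> u \<le> exp L \<Longrightarrow>
      c * u / L + 3 * exp (L / 2) \<le> real (card {p. prime p \<and> real p \<le> u})"
    using large_prime_count_bound by blast
  obtain C1 where C1: "C1 > 0" and mertens: "\<And>z y::real. 2 \<le> z \<Longrightarrow> z \<le> y \<Longrightarrow>
     ln (ln y / ln z) - C1 \<le> (\<Sum>p | prime p \<and> z < real p \<and> real p \<le> y. 1 / real p)"
    using mertens_second by blast
  \<comment> \<open>Mertens' theorem over the chosen range loses ln 16 and \<open>C1\<close>; the 2
    covers the primes dividing q and the reserve in \<open>sum_prod_subsets_ge\<close>, each of
    which costs at most 1.\<close>
  define C2 where "C2 = ln 16 + C1 + 2"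
  have C2: "C2 > 0" "C2 \<ge> ln 16" using C1 by (auto simp: C2_def intro!: add_pos_pos)
  \<comment> \<open>\<open>3 * L0\<close> settles bounded x. The 6 consists of 1 for exp(-k), 1 for
    rounding t and 4 from \<open>balanced_weight_ge\<close>.\<close>
  define C where "C = \<bar>ln c\<bar> + C2 + 3 * L0 + 6"
  have C: "C > 0" "C \<ge> 3 * L0" "C \<ge> \<bar>ln c\<bar> + 1 + C2 + 5" "C \<ge> 4" using C2 L0 by (auto simp: C_def)
  have "exp (real k * ln x - (2 * real k - 1) * ln (ln x) + (real k)\<^sup>2 * ln (ln x / (real k * ln (real K)))
         - C * (real k)\<^sup>2 - C * (real k)\<^sup>2 * ln (ln (ln x / (real k * ln (real K)))))
       \<le> real (card {(ms, ns) \<in> product_pairs (pos_upto x) k. prod_list ms \<in> flat_upto q (x ^ k)})"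
    if q: "q \<ge> 1" and k: "k \<ge> 1" and K: "K = max k (card (prime_factors q))" "K \<ge> 2"
      and x: "x \<ge> real K powr (exp 1 * real k)" for q k K :: nat and x :: real
  proof -
    let ?T = "{(ms, ns) \<in> product_pairs (pos_upto x) k. prod_list ms \<in> flat_upto q (x ^ k)}"
    define L where "L = ln x"
    define l where "l = ln (real K)"
    define W where "W = L / (real k * l)"
    define w where "w = ln W"
    note pars = flat_pairs_parameters[OF k K x, folded L_def, folded l_def, folded W_def, folded w_def]
    have kr: "real k \<ge> 1" using k by simp
    have k2: "real k \<le> (real k)\<^sup>2" using kr by (simp add: power2_eq_square)
    have lnw: "0 \<le> ln w" using pars by simp
    have lnL: "0 \<le> ln L" using pars by simp
    have e2: "exp 1 \<ge> (2::real)" using exp_ge_add_one_self[of "1::real"] by simp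
    have xL: "x = exp L" using pars(1) by (simp add: L_def)
    define E where "E = real k * L - (2 * real k - 1) * ln L + (real k)\<^sup>2 * w - C * (real k)\<^sup>2 - C * (real k)\<^sup>2 * ln w"
    have "exp E \<le> real (card ?T)"
    proof (cases "L < L0")
      \<comment> \<open>For bounded x the exponent is not positive, and the pair of all-one tuples
        suffices. Here W <= 3L/2 because k ln K >= 2/3.\<close>
      case True
      have "real k * L \<le> (real k)\<^sup>2 * L0" using True pars k2 by (intro mult_mono) auto
      moreover have "0 \<le> (2 * real k - 1) * ln L" using lnL kr by (intro mult_nonneg_nonneg) auto
      moreover have "(real k)\<^sup>2 * w \<le> (real k)\<^sup>2 * (2 * L0)"
      proof (intro mult_left_mono)
        have "1 * (2/3) * W \<le> real k * l * W" using kr pars e2 by (intro mult_right_mono mult_mono) auto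
        then show "w \<le> 2 * L0" using pars True by linarith
      qed auto
      moreover have "(real k)\<^sup>2 * (3 * L0) \<le> C * (real k)\<^sup>2" using mult_right_mono[OF C(2), of "(real k)\<^sup>2"] by (simp add: mult_ac)
      moreover have "0 \<le> C * (real k)\<^sup>2 * ln w" using C lnw by (intro mult_nonneg_nonneg) auto
      ultimately have "E \<le> 0" unfolding E_def by (simp add: algebra_simps)
      then have "exp E \<le> 1" by simp
      also have "1 \<le> real (card ?T)" using card_flat_pairs_ge_1[of x k q] pars by simp
      finally show ?thesis .
    next
      case False
      then have LL0: "L \<ge> L0" "L \<ge> 2" using L0 by auto
      \<comment> \<open>Since J = kt <= kw, products of J primes up to y stay below x^(1/8).\<close>
      define y where "y = exp (L / (8 * real k * w))"
      \<comment> \<open>K^(2w) is at least K, which controls the primes dividing q, and at least k^2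
        t: here K^2 bounds k^2, while K^(2(w-1)) >= exp(w-1) >= w >= t.\<close>
      define z where "z = exp (2 * w * l)"
      \<comment> \<open>ln y / ln z equals W / (16 w^2), whose logarithm is w - 2 ln w - ln 16. A
        negative value is truncated to t = 0; then J = 0, only the empty set of primes is used, and
        \<open>F\<close> below is 1.\<close>
      define t where "t = nat \<lfloor>w - 2 * ln w - C2\<rfloor>"
      define J where "J = k * t"
      define P where "P = {p. prime p \<and> z < real p \<and> real p \<le> y \<and> \<not> p dvd q}"
      define \<kappa> where "\<kappa> = c * x / L"
      define B where "B = nat \<lfloor>L\<rfloor>"
      have w1: "w \<ge> 1" using pars by simp
      have t_le: "real t \<le> w" using lnw C2 w1 unfolding t_def by linarith
      have t_ge: "w - 2 * ln w - C2 - 1 \<le> real t" unfolding t_def by linarith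
      have kw: "real k * w \<ge> 1" using kr w1 mult_mono[of 1 "real k" 1 w] by simp
      have y_le: "y \<le> exp (L / 2)"
      proof -
        have "L / (8 * (real k * w)) \<le> L / 2"
        proof (intro divide_left_mono)
          show "2 \<le> 8 * (real k * w)" "0 < 8 * (real k * w) * 2" using kw by linarith+
        qed (use LL0 in simp)
        then show ?thesis by (simp add: y_def mult.assoc)
      qed
      have yJ: "y ^ J \<le> exp (L / 8)"
      proof -
        have "y ^ J = exp (real J * (L / (8 * real k * w)))" unfolding y_def by (rule exp_of_nat_mult[symmetric])
        also have "real J * (L / (8 * real k * w)) = L / 8 * (real t / w)" using kr w1 by (simp add: J_def field_simps)
        also have "\<dots> \<le> L / 8 * 1" using t_le w1 LL0 by (intro mult_left_mono) auto
        finally show ?thesis by simp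
      qed
      have z1: "real K \<le> z" "2 \<le> z" "(real k)\<^sup>2 * real t \<le> z"
      proof -
        have "l \<le> 2 * w * l" using w1 pars by simp
        then have "exp l \<le> z" by (simp add: z_def)
        then show "real K \<le> z" using K by (simp add: l_def)
        then show "2 \<le> z" using K by simp
        have "w \<le> exp (w - 1)" using exp_ge_add_one_self[of "w - 1"] by simp
        also have "\<dots> \<le> exp (2 * (w - 1) * l)"
        proof -
          have "(w - 1) * 1 \<le> (w - 1) * (2 * l)" using w1 pars by (intro mult_left_mono) auto
          then show ?thesis by (simp add: mult_ac)
        qed
        finally have w_le: "w \<le> exp (2 * (w - 1) * l)" .
        have "real k \<le> exp l" using K by (simp add: l_def)
        then have "(real k)\<^sup>2 \<le> exp l ^ 2" by (intro power_mono) auto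
        then have "(real k)\<^sup>2 \<le> exp (2 * l)" by (simp add: exp_double)
        then have "(real k)\<^sup>2 * real t \<le> exp (2 * l) * exp (2 * (w - 1) * l)"
          using w_le t_le by (intro mult_mono) auto
        also have "\<dots> = z" by (simp add: z_def exp_add[symmetric] algebra_simps)
        finally show "(real k)\<^sup>2 * real t \<le> z" .
      qed
      have finP: "finite P"
        by (rule finite_subset[of _ "{..nat \<lfloor>y\<rfloor>}"]) (auto simp: P_def le_nat_floor)
      have n: "real (k * J) = (real k)\<^sup>2 * real t" by (simp add: J_def power2_eq_square)
      have "real t + real (k * J) * (1 / z) \<le> (\<Sum>p\<in>P. 1 / real p)"
      proof (cases "t = 0")
        case True
        then show ?thesis by (simp add: J_def sum_nonneg)
      next
        case False
        then have pos: "w - 2 * ln w - C2 \<ge> 1" unfolding t_def by linarith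
        have "real t \<le> w - 2 * ln w - C2" using pos unfolding t_def by linarith
        have ratio: "ln y / ln z = W / (16 * w\<^sup>2)"
        proof -
          have "real k * l * W / (8 * real k * w) / (2 * w * l) = W / (16 * w\<^sup>2)"
            using kr w1 pars by (simp add: field_simps power2_eq_square)
          then show ?thesis using pars(2) by (simp add: y_def z_def)
        qed
        have lnr: "ln (W / (16 * w\<^sup>2)) = w - ln 16 - 2 * ln w"
          using pars w1 by (simp add: ln_div ln_mult ln_realpow w_def[symmetric])
        have zy: "z \<le> y"
        proof -
          have "0 \<le> ln (W / (16 * w\<^sup>2))" unfolding lnr using pos C2 by linarith
          moreover have "W / (16 * w\<^sup>2) > 0" using pars(5) w1 exp_gt_zero[of "1::real"] by (intro divide_pos_pos) (linarith, auto)
          ultimately have "1 \<le> ln y / ln z" unfolding ratio by (simp add: ln_ge_zero_iff)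
          then have "2 * w * l \<le> L / (8 * real k * w)" using w1 pars by (simp add: y_def z_def)
          then show ?thesis by (simp add: y_def z_def)
        qed
        have "w - ln 16 - 2 * ln w - C1 \<le> (\<Sum>p | prime p \<and> z < real p \<and> real p \<le> y. 1 / real p)"
          using mertens[OF z1(2) zy] unfolding ratio lnr .
        moreover have "(\<Sum>p | prime p \<and> z < real p \<and> real p \<le> y. 1 / real p) - real (card (prime_factors q)) / z \<le> (\<Sum>p\<in>P. 1 / real p)"
          unfolding P_def using z1 by (intro sum_inverse_primes_coprime_ge q) (auto simp: y_def)
        moreover have "real (card (prime_factors q)) / z \<le> 1" using z1 K(1) by simp
        moreover have "real (k * J) * (1 / z) \<le> 1" using z1 unfolding n by simp
        ultimately show ?thesis using \<open>real t \<le> w - 2 * ln w - C2\<close> unfolding C2_def by linarith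
      qed
      then have esym: "real t ^ (k * J) / fact (k * J) \<le> (\<Sum>A | A \<subseteq> P \<and> card A = k * J. \<Prod>p\<in>A. 1 / real p)"
        using finP z1 by (intro sum_prod_subsets_ge[where \<delta> = "1 / z"]) (auto simp: P_def intro!: divide_left_mono)
      have \<kappa>: "\<kappa> > 0" using c LL0 by (simp add: \<kappa>_def xL)
      have H: "\<kappa> / real m + real k \<le> real (card (big_primes q x y m))" if m: "0 < m" "real m \<le> y ^ J" for m
      proof -
        have u: "exp (7 * L / 8) \<le> x / real m" "x / real m \<le> exp L"
        proof -
          have "exp (7 * L / 8) * real m \<le> exp (7 * L / 8) * exp (L / 8)" using m yJ by (intro mult_left_mono) auto
          also have "\<dots> = x" by (simp add: xL exp_add[symmetric])
          finally show "exp (7 * L / 8) \<le> x / real m" using m by (simp add: field_simps)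
          have "x / real m \<le> x / 1" using m by (intro divide_left_mono) (auto simp: xL)
          then show "x / real m \<le> exp L" by (simp add: xL)
        qed
        have "c * (x / real m) / L + 3 * exp (L / 2) \<le> real (card {p. prime p \<and> real p \<le> x / real m})"
          by (rule count[OF LL0(1) u])
        moreover have "c * (x / real m) / L = \<kappa> / real m" by (simp add: \<kappa>_def)
        moreover have "real (card {p. prime p \<and> real p \<le> x / real m}) - y - real (card (prime_factors q))
            \<le> real (card (big_primes q x y m))" by (rule card_big_primes_ge[OF q m(1)]) (simp add: y_def)
        moreover have "real k \<le> exp (L / 2)" "real (card (prime_factors q)) \<le> exp (L / 2)"
          using pars(9) K(1) by linarith+
        ultimately show ?thesis using y_le by linarith
      qed
      have Bm: "log_floor m < B" if m: "0 < m" "real m \<le> y ^ J" for m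
      proof -
        have "real m \<le> exp (L / 8)" using m yJ by linarith
        then have "ln (real m) \<le> ln (exp (L / 8))" using m by (subst ln_le_cancel_iff) auto
        then have "ln (real m) \<le> L / 8" by simp
        then show ?thesis using LL0(2) unfolding log_floor_def B_def by linarith
      qed
      have B1: "real B > 0" "real B \<le> L" using LL0 unfolding B_def by linarith+
      define F where "F = (fact (k * J) / fact J ^ k)\<^sup>2 * (real t ^ (k * J) / fact (k * J))"
      \<comment> \<open>Rounding t costs 1, Stirling 4. The two terms 2 ln w come from the
        definition of t and from 2 ln t.\<close>
      have F: "exp ((real k)\<^sup>2 * (w - 4 * ln w - C2 - 5)) \<le> F"
      proof (cases "t = 0")
        case True
        then have "w - 4 * ln w - C2 - 5 \<le> 0" using t_ge lnw by simp
        then have "(real k)\<^sup>2 * (w - 4 * ln w - C2 - 5) \<le> 0" by (simp add: mult_nonneg_nonpos)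
        then show ?thesis using True by (simp add: F_def J_def)
      next
        case False
        then have "ln (real t) \<le> ln w" using t_le by (subst ln_le_cancel_iff) auto
        then have "(real k)\<^sup>2 * (w - 4 * ln w - C2 - 5) \<le> (real k)\<^sup>2 * (real t - 4 - 2 * ln (real t))"
          using t_ge by (intro mult_left_mono) auto
        then have "exp ((real k)\<^sup>2 * (w - 4 * ln w - C2 - 5)) \<le> exp ((real k)\<^sup>2 * (real t - 4 - 2 * ln (real t)))"
          by simp
        also have "\<dots> \<le> F" using balanced_weight_ge[OF k, of t] False by (simp add: F_def J_def)
        finally show ?thesis .
      qed
      \<comment> \<open>The right side is the logarithm of \<kappa>^k exp(-k) / L^(k-1) times the
        bound for \<open>F\<close>; k <= k^2 turns the errors linear in k into multiples of
        k^2.\<close>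
      have "E \<le> (real k * (ln c + L - ln L) - real k - (real k - 1) * ln L) + (real k)\<^sup>2 * (w - 4 * ln w - C2 - 5)"
      proof -
        have "real k * (- \<bar>ln c\<bar> - 1) \<le> real k * (ln c - 1)" by (intro mult_left_mono) auto
        moreover have "real k * (\<bar>ln c\<bar> + 1) \<le> (real k)\<^sup>2 * (\<bar>ln c\<bar> + 1)" using k2 by (intro mult_right_mono) auto
        moreover have "(real k)\<^sup>2 * (\<bar>ln c\<bar> + 1 + C2 + 5) \<le> (real k)\<^sup>2 * C" using C by (intro mult_left_mono) auto
        moreover have "(real k)\<^sup>2 * (4 * ln w) \<le> (real k)\<^sup>2 * (C * ln w)" using C lnw by (intro mult_left_mono mult_right_mono) auto
        ultimately show ?thesis unfolding E_def by (simp add: algebra_simps)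
      qed
      then have "exp E \<le> exp (real k * (ln c + L - ln L) - real k - (real k - 1) * ln L) * exp ((real k)\<^sup>2 * (w - 4 * ln w - C2 - 5))"
        by (simp only: exp_add[symmetric] exp_le_cancel_iff)
      also have "exp (real k * (ln c + L - ln L) - real k - (real k - 1) * ln L) = \<kappa> ^ k * exp (- real k) / L ^ (k - 1)"
      proof -
        have "exp (ln c + L - ln L) = \<kappa>" using c LL0 by (simp add: exp_add exp_diff \<kappa>_def xL)
        then have "exp (real k * (ln c + L - ln L)) = \<kappa> ^ k" by (simp add: exp_of_nat_mult)
        moreover have "exp ((real k - 1) * ln L) = L ^ (k - 1)"
          using exp_of_nat_mult[of "k - 1" "ln L"] k LL0 by (simp add: of_nat_diff)
        ultimately show ?thesis by (simp add: exp_diff exp_minus divide_inverse)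
      qed
      also have "\<dots> * exp ((real k)\<^sup>2 * (w - 4 * ln w - C2 - 5)) \<le> (\<kappa> ^ k * exp (- real k) / real B ^ (k - 1)) * F"
        using \<kappa> B1 LL0 F by (intro mult_mono divide_left_mono power_mono mult_pos_pos) auto
      also have "\<dots> \<le> \<kappa> ^ k * exp (- real k) / real B ^ (k - 1) * ((fact (k * J) / fact J ^ k)\<^sup>2 *
          (\<Sum>A | A \<subseteq> P \<and> card A = k * J. \<Prod>p\<in>A. 1 / real p))"
        unfolding F_def using \<kappa> B1 esym by (intro mult_left_mono) auto
      also have "\<dots> \<le> real (card ?T)"
        unfolding mult.assoc[symmetric]
        by (rule card_flat_pairs_ge[OF k q finP _ \<kappa> H Bm]) (auto simp: P_def)
      finally show ?thesis .
    qed
    then show ?thesis unfolding E_def w_def W_def L_def l_def .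
  qed
  then show ?thesis using C(1) by blast
qed

text \<open>In the upper bound the natural power is taken before the real one, because for k = 1, x
  = 1 it must be 0^0 = 1, whereas \<open>powr\<close> with base 0 gives 0. The guard K >= 2 keeps ln
  K away from 0. At W = e the power of ln W is 1 and absorbs no constant, hence the separate factor
  exp(-Ck).\<close>

theorem theorem4p1:
  "\<exists>C>0::real. \<forall>(M :: 'a measure) (X :: nat \<Rightarrow> 'a \<Rightarrow> complex) (q::nat) (k::nat) (x::real) (K::nat).
     random_completely_multiplicative M X \<longrightarrow> q \<ge> 1 \<longrightarrow> k \<ge> 1 \<longrightarrow>
     K = max k (card (prime_factors q)) \<longrightarrow> x \<ge> real K powr (exp 1 * real k) \<longrightarrow>
       moment_norm M k (\<lambda>\<omega>. \<Sum>n\<in>flat_upto q x. X n \<omega>)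
         \<le> moment_norm M k (\<lambda>\<omega>. \<Sum>n\<in>pos_upto x. X n \<omega>)
     \<and> moment_norm M k (\<lambda>\<omega>. \<Sum>n\<in>pos_upto x. X n \<omega>)
         \<le> x powr (1/2) * ((ln x / real k) ^ ((k - 1)^2)) powr (1 / (2 * real k)) * exp (C * real k)
     \<and> moment_norm M k (\<lambda>\<omega>. \<Sum>n\<in>flat_upto q x. X n \<omega>)
         \<ge> (\<Sum>N\<in>flat_upto q (x ^ k). real (restricted_divisor k N x) ^ 2) powr (1 / (2 * real k))
     \<and> (K \<ge> 2 \<longrightarrow>
         (\<Sum>N\<in>flat_upto q (x ^ k). real (restricted_divisor k N x) ^ 2) powr (1 / (2 * real k))
           \<ge> x powr (1/2) / ln x powr (1 - 1 / (2 * real k))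
               * (ln x / (real k * ln (real K))) powr (real k / 2)
               * exp (- (C * real k)) * ln (ln x / (real k * ln (real K))) powr (- (C * real k)))"
proof -
  obtain C0 where C0: "C0 > 0" and lower: "\<And>(q::nat) (k::nat) (x::real) (K::nat). q \<ge> 1 \<Longrightarrow> k \<ge> 1 \<Longrightarrow>
     K = max k (card (prime_factors q)) \<Longrightarrow> K \<ge> 2 \<Longrightarrow> x \<ge> real K powr (exp 1 * real k) \<Longrightarrow>
     exp (real k * ln x - (2 * real k - 1) * ln (ln x) + (real k)\<^sup>2 * ln (ln x / (real k * ln (real K)))
         - C0 * (real k)\<^sup>2 - C0 * (real k)\<^sup>2 * ln (ln (ln x / (real k * ln (real K)))))
       \<le> real (card {(ms, ns) \<in> product_pairs (pos_upto x) k. prod_list ms \<in> flat_upto q (x ^ k)})"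
    using card_flat_pairs_exp_ge by blast
  \<comment> \<open>The upper bound needs 7/2, the 2k-th root of exp(7 k^2) being exp(7k/2); the
    lower bound needs \<open>C0 / 2\<close>.\<close>
  define C where "C = C0 + 4"
  show ?thesis
  proof (intro exI[of _ C] conjI allI impI)
    show "C > 0" using C0 by (simp add: C_def)
    fix M :: "'a measure" and X :: "nat \<Rightarrow> 'a \<Rightarrow> complex" and q k K :: nat and x :: real
    assume rcm: "random_completely_multiplicative M X" and q: "q \<ge> 1" and k: "k \<ge> 1"
      and K: "K = max k (card (prime_factors q))" and x: "x \<ge> real K powr (exp 1 * real k)"
    interpret random_completely_multiplicative M X by fact
    let ?r = "1 / (2 * real k)"
    let ?T = "{(ms, ns) \<in> product_pairs (pos_upto x) k. prod_list ms \<in> flat_upto q (x ^ k)}"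
    have r: "?r > 0" using k by simp
    have Kk: "real K \<ge> 1" "real K \<ge> real k" using K k by auto
    have "real K powr (exp 1 * real k) \<ge> 1" using Kk by (intro ge_one_powr_ge_zero) auto
    then have x1: "x \<ge> 1" using x by linarith
    have flat_sub: "flat_upto q x \<subseteq> pos_upto x" for x by (auto simp: flat_upto_def)
    have fin: "finite (pos_upto x)" "finite (flat_upto q x)" for x
      using finite_pos_upto finite_subset[OF flat_sub] by blast+
    have full: "moment_norm M k (\<lambda>\<omega>. \<Sum>n\<in>pos_upto x. X n \<omega>) = real (card (product_pairs (pos_upto x) k)) powr ?r"
      unfolding moment_norm_def using fin
      by (subst moment_eq_card_product_pairs) (auto simp: pos_upto_def)
    have flat: "moment_norm M k (\<lambda>\<omega>. \<Sum>n\<in>flat_upto q x. X n \<omega>) = real (card (product_pairs (flat_upto q x) k)) powr ?r"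
      unfolding moment_norm_def using fin
      by (subst moment_eq_card_product_pairs) (auto simp: flat_upto_def pos_upto_def)
    have sumd: "(\<Sum>N\<in>flat_upto q (x ^ k). real (restricted_divisor k N x) ^ 2) = real (card ?T)"
      by (rule sum_restricted_divisor_sq[OF fin(2)])
    show "moment_norm M k (\<lambda>\<omega>. \<Sum>n\<in>flat_upto q x. X n \<omega>) \<le> moment_norm M k (\<lambda>\<omega>. \<Sum>n\<in>pos_upto x. X n \<omega>)"
    proof -
      have "product_pairs (flat_upto q x) k \<subseteq> product_pairs (pos_upto x) k"
        using flat_sub by (auto simp: product_pairs_def)
      then have "card (product_pairs (flat_upto q x) k) \<le> card (product_pairs (pos_upto x) k)"
        by (rule card_mono[OF finite_product_pairs[OF fin(1)]])
      then show ?thesis unfolding full flat using r by (intro powr_mono2) auto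
    qed
    show "moment_norm M k (\<lambda>\<omega>. \<Sum>n\<in>pos_upto x. X n \<omega>)
         \<le> x powr (1/2) * ((ln x / real k) ^ ((k - 1)^2)) powr ?r * exp (C * real k)"
    proof -
      have "real k powr (exp 1 * real k) \<le> x" using x Kk powr_mono2[of "exp 1 * real k" "real k" "real K"] by simp
      then have "real (card (product_pairs (pos_upto x) k)) \<le> x ^ k * (ln x / real k) ^ (k - 1)\<^sup>2 * exp (7 * real (k\<^sup>2))"
        using card_product_pairs_pos_upto_le[OF k] by simp
      then have "real (card (product_pairs (pos_upto x) k)) powr ?r
          \<le> (x ^ k * (ln x / real k) ^ (k - 1)\<^sup>2 * exp (7 * real (k\<^sup>2))) powr ?r"
        using r by (intro powr_mono2) auto
      also have "\<dots> = (x ^ k) powr ?r * ((ln x / real k) ^ (k - 1)\<^sup>2) powr ?r * exp (7 * real (k\<^sup>2)) powr ?r"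
        using x1 by (simp add: powr_mult)
      also have "(x ^ k) powr ?r = x powr (1/2)"
        using x1 k by (simp add: powr_realpow[symmetric] powr_powr)
      also have "exp (7 * real (k\<^sup>2)) powr ?r = exp (7 / 2 * real k)"
        using k by (simp add: powr_def power2_eq_square)
      also have "x powr (1/2) * ((ln x / real k) ^ (k - 1)\<^sup>2) powr ?r * exp (7 / 2 * real k)
          \<le> x powr (1/2) * ((ln x / real k) ^ (k - 1)\<^sup>2) powr ?r * exp (C * real k)"
      proof (intro mult_left_mono)
        have "7 / 2 * real k \<le> C * real k" using C0 by (intro mult_right_mono) (auto simp: C_def)
        then show "exp (7 / 2 * real k) \<le> exp (C * real k)" by simp
      qed auto
      finally show ?thesis unfolding full .
    qed
    show "(\<Sum>N\<in>flat_upto q (x ^ k). real (restricted_divisor k N x) ^ 2) powr ?r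
        \<le> moment_norm M k (\<lambda>\<omega>. \<Sum>n\<in>flat_upto q x. X n \<omega>)"
    proof -
      \<comment> \<open>Every entry of either tuple divides the common product, and divisors of a
        squarefree number coprime to q are again squarefree and coprime to q.\<close>
      have "?T \<subseteq> product_pairs (flat_upto q x) k"
      proof clarify
        fix ms ns assume T: "(ms, ns) \<in> product_pairs (pos_upto x) k" "prod_list ms \<in> flat_upto q (x ^ k)"
        have "m \<in> flat_upto q x" if "m \<in> set ms \<union> set ns" for m
        proof -
          have "m dvd prod_list ms" using that T(1) by (auto simp: product_pairs_def dest!: prod_list_dvd)
          moreover have "m \<in> pos_upto x" using that T(1) by (auto simp: product_pairs_def)
          ultimately show ?thesis using T(2)
            by (auto simp: flat_upto_def intro: squarefree_mono coprime_divisors[of m "prod_list ms" q q])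
        qed
        then show "(ms, ns) \<in> product_pairs (flat_upto q x) k" using T(1) by (auto simp: product_pairs_def)
      qed
      then have "card ?T \<le> card (product_pairs (flat_upto q x) k)"
        by (rule card_mono[OF finite_product_pairs[OF fin(2)]])
      then show ?thesis unfolding flat sumd using r by (intro powr_mono2) auto
    qed
    assume K2: "K \<ge> 2"
    define L where "L = ln x"
    define W where "W = L / (real k * ln (real K))"
    define w where "w = ln W"
    note pars = flat_pairs_parameters[OF k K K2 x, folded L_def, folded W_def, folded w_def]
    have kr: "real k > 0" using k by simp
    have lnw: "0 \<le> ln w" using pars by simp
    let ?E = "real k * L - (2 * real k - 1) * ln L + (real k)\<^sup>2 * w - C0 * (real k)\<^sup>2 - C0 * (real k)\<^sup>2 * ln w"
    have "x powr (1/2) / L powr (1 - ?r) * W powr (real k / 2) * exp (- (C * real k)) * w powr (- (C * real k))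
        = exp (L / 2 - (1 - ?r) * ln L + real k / 2 * w - C * real k - C * real k * ln w)"
    proof -
      have "x powr (1/2) = exp (L / 2)" using pars(1) by (simp add: powr_def L_def)
      moreover have "L powr (1 - ?r) = exp ((1 - ?r) * ln L)" using pars(8) by (simp add: powr_def)
      moreover have "W powr (real k / 2) = exp (real k / 2 * w)" using pars(10) by (simp add: powr_def)
      moreover have "w powr (- (C * real k)) = exp (- (C * real k) * ln w)" using pars(6) by (simp add: powr_def)
      ultimately show ?thesis
        by (simp only: exp_add[symmetric] exp_diff[symmetric]) (simp add: algebra_simps)
    qed
    also have "\<dots> \<le> exp (?r * ?E)"
    proof -
      \<comment> \<open>Division by 2k turns 2k - 1 into 1 - 1/(2k) and k^2 into k/2.\<close>
      have "?r * ?E = L / 2 - (1 - ?r) * ln L + real k / 2 * w - C0 / 2 * real k - C0 / 2 * (real k * ln w)"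
        using kr by (simp add: field_simps power2_eq_square)
      moreover have "C0 / 2 * real k \<le> C * real k" using C0 by (intro mult_right_mono) (auto simp: C_def)
      moreover have "C0 / 2 * (real k * ln w) \<le> C * (real k * ln w)"
        using C0 lnw by (intro mult_right_mono) (auto simp: C_def)
      ultimately show ?thesis by simp
    qed
    also have "\<dots> = exp ?E powr ?r" by (simp add: powr_def)
    also have "\<dots> \<le> real (card ?T) powr ?r"
      using lower[OF q k K K2 x, folded L_def, folded W_def, folded w_def] r by (intro powr_mono2) auto
    finally show "x powr (1/2) / ln x powr (1 - ?r) * (ln x / (real k * ln (real K))) powr (real k / 2)
               * exp (- (C * real k)) * ln (ln x / (real k * ln (real K))) powr (- (C * real k))
        \<le> (\<Sum>N\<in>flat_upto q (x ^ k). real (restricted_divisor k N x) ^ 2) powr ?r"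
      unfolding sumd w_def W_def L_def .
  qed
qed

end
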